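(* Let $k\ge2$, $m\ge1$ and $0<\alpha<1$. Among all $k$-uniform hypertrees with $m$ hyperedges, the last hypertree in $S_\alpha$-order is the hyperstar $S_m^{(k)}$.
   Context: Hypergraphs are finite; $k$-uniform means every hyperedge has exactly $k$ vertices; a hypertree is a connected hypergraph without cycles. The hyperstar $S_m^{(k)}$ consists of $m$ hyperedges of size $k$ which all share one common vertex and are otherwise pairwise disjoint. For a $k$-uniform hypergraph $\mathcal{H}$ on $[n]$, $\mathcal{A}(\mathcal{H})$ is the $k$-order $n$-dimensional tensor with entry $\frac1{(k-1)!}$ at $(i_1,\dots,i_k)$ if $\{i_1,\dots,i_k\}\in E(\mathcal{H})$ and $0$ otherwise; $\mathcal{D}(\mathcal{H})$ is the diagonal tensor of vertex degrees; $\mathcal{A}_\alpha(\mathcal{H})=\alpha\mathcal{D}(\mathcal{H})+(1-\alpha)\mathcal{A}(\mathcal{H})$. For a tensor $\mathcal{T}$, $\mathrm{Tr}_d(\mathcal{T})$ is the sum of the $d$-th powers of all $n(k-1)^{n-1}$ eigenvalues of $\mathcal{T}$ (roots of its characteristic polynomial, with multiplicity); in particular $\mathrm{Tr}_0(\mathcal{T})=n(k-1)^{n-1}$, and for $d\ge1$ $$\mathrm{Tr}_{d}(\mathcal{T})=(k-1)^{n-1}\sum_{d_1+\cdots+d_n=d}\ \prod_{i=1}^{n}\frac{1}{(d_i(k-1))!}\Big(\sum_{\gamma\in[n]^{k-1}}(\mathcal{T})_{i\gamma}\frac{\partial}{\partial a_{i\gamma}}\Big)^{d_i}\mathrm{tr}\big(A^{d(k-1)}\big),$$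 with $A=(a_{ij})$ an $n\times n$ matrix of indeterminates, $d_i\ge0$ integers, $\frac{\partial}{\partial a_{i\gamma}}=\frac{\partial}{\partial a_{i i_2}}\cdots\frac{\partial}{\partial a_{i i_k}}$ for $\gamma=i_2\cdots i_k$. $S_\alpha$-order: for $k$-uniform hypergraphs $\mathcal{H}_1,\mathcal{H}_2$ with $n$ vertices, $\mathcal{H}_1\prec_\alpha\mathcal{H}_2$ if there is $d\in\{1,\dots,n(k-1)^{n-1}-1\}$ with $\mathrm{Tr}_t(\mathcal{A}_\alpha(\mathcal{H}_1))=\mathrm{Tr}_t(\mathcal{A}_\alpha(\mathcal{H}_2))$ for $t=0,\dots,d-1$ and $\mathrm{Tr}_d(\mathcal{A}_\alpha(\mathcal{H}_1))<\mathrm{Tr}_d(\mathcal{A}_\alpha(\mathcal{H}_2))$. "$X$ is the last hypertree in a class" means $X$ is in the class and $\mathcal{H}\prec_\alpha X$ for every $\mathcal{H}$ in the class not isomorphic to $X$. *)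

theory Defs
  imports
    "HOL-Library.Multiset"
    "HOL-Computational_Algebra.Polynomial"
    "Jordan_Normal_Form.Determinant"
begin

section \<open>Hypergraphs\<close>

text \<open>The vertex set [n] is rendered as \<open>{..<n}\<close>.\<close>

record hypergraph =
  nverts :: nat
  hyperedges :: "nat set set"

definition hypergraph :: "hypergraph \<Rightarrow> bool" where
  "hypergraph H \<longleftrightarrow> hyperedges H \<subseteq> Pow {..<nverts H}"

definition uniform :: "nat \<Rightarrow> hypergraph \<Rightarrow> bool" where
  "uniform k H \<longleftrightarrow> (\<forall>e\<in>hyperedges H. card e = k)"

definition connected_hypergraph :: "hypergraph \<Rightarrow> bool" where
  "connected_hypergraph H \<longleftrightarrow>
     (\<forall>u<nverts H. \<forall>v<nverts H. (u, v) \<in> {(x, y). \<exists>e\<in>hyperedges H. x \<in> e \<and> y \<in> e}\<^sup>*)"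

text \<open>A (Berge) cycle \<open>v\<^sub>1 e\<^sub>1 v\<^sub>2 e\<^sub>2 \<dots> v\<^sub>l e\<^sub>l v\<^sub>1\<close>. Length 2 is allowed, so in an acyclic
  hypergraph two hyperedges share at most one vertex.\<close>

definition is_cycle :: "hypergraph \<Rightarrow> nat list \<Rightarrow> nat set list \<Rightarrow> bool" where
  "is_cycle H vs es \<longleftrightarrow>
     2 \<le> length es \<and> length vs = length es \<and> distinct vs \<and> distinct es \<and>
     set es \<subseteq> hyperedges H \<and>
     (\<forall>i<length es. vs ! i \<in> es ! i \<and> vs ! (Suc i mod length es) \<in> es ! i)"

definition hypertree :: "hypergraph \<Rightarrow> bool" where
  "hypertree H \<longleftrightarrow> hypergraph H \<and> connected_hypergraph H \<and> (\<nexists>vs es. is_cycle H vs es)"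

definition uniform_hypertrees :: "nat \<Rightarrow> nat \<Rightarrow> hypergraph set" where
  "uniform_hypertrees k m = {H. hypertree H \<and> uniform k H \<and> card (hyperedges H) = m}"

definition isomorphic :: "hypergraph \<Rightarrow> hypergraph \<Rightarrow> bool" where
  "isomorphic G H \<longleftrightarrow>
     (\<exists>f. bij_betw f {..<nverts G} {..<nverts H} \<and> hyperedges H = (\<lambda>e. f ` e) ` hyperedges G)"

text \<open>The common vertex is 0; the other vertices are split into \<open>m\<close> blocks of \<open>k - 1\<close>
  consecutive numbers.\<close>

definition hyperstar :: "nat \<Rightarrow> nat \<Rightarrow> hypergraph" where
  "hyperstar k m =
     \<lparr> nverts = m * (k - 1) + 1,
       hyperedges = (\<lambda>j. insert 0 {j * (k - 1) + 1 .. (j + 1) * (k - 1)}) ` {..<m} \<rparr>"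

section \<open>Tensors, eigenvalues and traces\<close>

text \<open>A tensor of order \<open>k\<close> and dimension \<open>n\<close> is a function on index lists; only its values on
  lists of length \<open>k\<close> with entries below \<open>n\<close> matter.\<close>

type_synonym tensor = "nat list \<Rightarrow> real"

definition adjacency_tensor :: "nat \<Rightarrow> hypergraph \<Rightarrow> tensor" where
  "adjacency_tensor k H is = (if set is \<in> hyperedges H then 1 / fact (k - 1) else 0)"

definition vertex_degree :: "hypergraph \<Rightarrow> nat \<Rightarrow> nat" where
  "vertex_degree H i = card {e \<in> hyperedges H. i \<in> e}"

definition degree_tensor :: "nat \<Rightarrow> hypergraph \<Rightarrow> tensor" where
  "degree_tensor k H is =
     (if is = replicate k (hd is) then real (vertex_degree H (hd is)) else 0)"

definition alpha_tensor :: "real \<Rightarrow> nat \<Rightarrow> hypergraph \<Rightarrow> tensor" where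
  "alpha_tensor \<alpha> k H is = \<alpha> * degree_tensor k H is + (1 - \<alpha>) * adjacency_tensor k H is"

text \<open>A monomial in the variables \<open>x\<^sub>0, \<dots>, x\<^sub>n\<^sub>-\<^sub>1\<close> is the multiset of the indices of its factors, and
  a form is given by its coefficients. The list below contains each monomial of degree \<open>D\<close> once.\<close>

definition monomials :: "nat \<Rightarrow> nat \<Rightarrow> nat multiset list" where
  "monomials n D = map mset (filter sorted (List.n_lists D [0..<n]))"

text \<open>
  Resultant of \<open>n\<close> forms \<open>F 0, \<dots>, F (n - 1)\<close> of degree \<open>d\<close> in \<open>n\<close> variables, as Macaulay's quotient of
  determinants. Rows and columns are indexed by the monomials of degree \<open>n (d - 1) + 1\<close>; each of
  them is divisible by some \<open>x\<^sub>i\<^sup>d\<close>, and if \<open>i\<close> is the least such index, row \<open>a\<close> holds the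
  coefficients of \<open>(a / x\<^sub>i\<^sup>d) F i\<close>. The denominator is the minor of the monomials that are
  divisible by \<open>x\<^sub>i\<^sup>d\<close> for at least two indices \<open>i\<close>. The normalisation is \<open>Res(x\<^sub>0\<^sup>d, \<dots>, x\<^sub>n\<^sub>-\<^sub>1\<^sup>d) = 1\<close>.

  Macaulay's theorem makes the division exact whenever the denominator is nonzero. For the
  forms of a characteristic polynomial (below) both matrices have the shape \<open>\<lambda>I - M\<close> with \<open>M\<close> a
  matrix of reals, so the denominator is even monic.
\<close>

definition macaulay_entry ::
    "nat \<Rightarrow> (nat \<Rightarrow> nat multiset \<Rightarrow> real poly) \<Rightarrow> nat multiset \<Rightarrow> nat multiset \<Rightarrow> real poly" where
  "macaulay_entry d F a b =
     (let i = (LEAST i. d \<le> count a i); c = a - replicate_mset d i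
      in if c \<subseteq># b then F i (b - c) else 0)"

definition macaulay_det ::
    "nat \<Rightarrow> (nat \<Rightarrow> nat multiset \<Rightarrow> real poly) \<Rightarrow> nat multiset list \<Rightarrow> real poly" where
  "macaulay_det d F ms =
     det (mat (length ms) (length ms) (\<lambda>(r, c). macaulay_entry d F (ms ! r) (ms ! c)))"

definition resultant :: "nat \<Rightarrow> nat \<Rightarrow> (nat \<Rightarrow> nat multiset \<Rightarrow> real poly) \<Rightarrow> real poly" where
  "resultant n d F =
     (let ms = monomials n (n * (d - 1) + 1)
      in macaulay_det d F ms
         div macaulay_det d F (filter (\<lambda>a. 2 \<le> card {i. i < n \<and> d \<le> count a i}) ms))"

text \<open>The forms \<open>\<lambda> x\<^sub>i\<^sup>k\<^sup>-\<^sup>1 - (T x\<^sup>k\<^sup>-\<^sup>1)\<^sub>i\<close>, with coefficients in the polynomials in \<open>\<lambda>\<close>.\<close>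

definition char_form :: "nat \<Rightarrow> nat \<Rightarrow> tensor \<Rightarrow> nat \<Rightarrow> nat multiset \<Rightarrow> real poly" where
  "char_form n k T i a =
     (if a = replicate_mset (k - 1) i then [:0, 1:] else 0) -
     [:\<Sum>\<gamma> | length \<gamma> = k - 1 \<and> set \<gamma> \<subseteq> {..<n} \<and> mset \<gamma> = a. T (i # \<gamma>):]"

definition tensor_char_poly :: "nat \<Rightarrow> nat \<Rightarrow> tensor \<Rightarrow> real poly" where
  "tensor_char_poly n k T = resultant n (k - 1) (char_form n k T)"

definition eigenvalues :: "nat \<Rightarrow> nat \<Rightarrow> tensor \<Rightarrow> complex multiset" where
  "eigenvalues n k T = proots (map_poly complex_of_real (tensor_char_poly n k T))"

text \<open>The characteristic polynomial is real, so the power sum is real and \<open>Re\<close> merely changes its type.\<close>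

definition tensor_trace :: "nat \<Rightarrow> nat \<Rightarrow> nat \<Rightarrow> tensor \<Rightarrow> real" where
  "tensor_trace d n k T = Re (\<Sum>x\<in>#eigenvalues n k T. x ^ d)"

section \<open>The order\<close>

definition S_less :: "real \<Rightarrow> nat \<Rightarrow> hypergraph \<Rightarrow> hypergraph \<Rightarrow> bool" where
  "S_less \<alpha> k G H \<longleftrightarrow> nverts G = nverts H \<and>
     (let n = nverts H;
          Tr = (\<lambda>t X. tensor_trace t n k (alpha_tensor \<alpha> k X))
      in \<exists>d\<in>{1..n * (k - 1) ^ (n - 1) - 1}.
           (\<forall>t<d. Tr t G = Tr t H) \<and> Tr d G < Tr d H)"

definition S_last :: "real \<Rightarrow> nat \<Rightarrow> hypergraph set \<Rightarrow> hypergraph \<Rightarrow> bool" where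
  "S_last \<alpha> k C X \<longleftrightarrow> X \<in> C \<and> (\<forall>H\<in>C. \<not> isomorphic H X \<longrightarrow> S_less \<alpha> k H X)"

end

theory Submission
  imports Defs "Jordan_Normal_Form.Schur_Decomposition"
begin

text \<open>
  The traces of order 0 and 1 agree for all hypertrees of the class, and the trace of order 2
  decides: up to terms common to the class it is a positive multiple of the sum of the squared
  vertex degrees. That sum equals the sum of \<open>\<bar>e \<inter> e'\<bar>\<close> over all pairs of hyperedges. Distinct
  hyperedges of a hypertree share at most one vertex, so the sum is largest exactly when all
  hyperedges meet pairwise; by acyclicity they then have a common vertex, and the hypertree is the
  hyperstar.

  For the traces, both determinants in Macaulay's quotient are characteristic polynomials of real
  matrices, and the power sums of order at most 2 of the roots of the quotient are differences of
  traces of powers of these matrices.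
\<close>

section \<open>Power sums of roots\<close>

text \<open>No determinant is ever expanded: power sums of order at most 2 see only diagonal entries
  and products of two opposite entries of the Macaulay matrices. A diagonal entry is
  \<open>\<alpha>\<close> times the degree of the vertex assigned to the row. Once the denominator
  is subtracted, every vertex keeps the same number of rows, so order 1 yields a multiple of the
  degree sum \<open>m * k\<close>, and order 2 a multiple of the sum of squared degrees. Opposite
  entries have product zero for k \<ge> 3; for k = 2 they add (1 - \<alpha>)^2 times the degree sum,
  again common to the class. The squared degrees carry the factor \<alpha>^2, and this is where 0 <
  \<alpha> enters. Small cases would be an obstacle, since the quotient of determinants needs degree
  at least 3 and order 2 has to lie in the admissible range. They do not arise: a hypertree other
  than the hyperstar has two disjoint hyperedges, hence at least 2k \<ge> 4 vertices.\<close>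

lemma coeff_reflect_linear_factors:
  fixes A :: "'a::idom multiset"
  defines "c \<equiv> coeff (reflect_poly (\<Prod>x\<in>#A. [:-x, 1:]))"
  shows "c 0 = 1" "c 1 = - (\<Sum>x\<in>#A. x)" "2 * c 2 = (\<Sum>x\<in>#A. x)\<^sup>2 - (\<Sum>x\<in>#A. x\<^sup>2)"
proof -
  have "c 0 = 1 \<and> c 1 = - (\<Sum>x\<in>#A. x) \<and> 2 * c 2 = (\<Sum>x\<in>#A. x)\<^sup>2 - (\<Sum>x\<in>#A. x\<^sup>2)"
    unfolding c_def
  proof (induction A)
    case empty
    then show ?case by (simp add: numeral_2_eq_2)
  next
    case (add y A)
    let ?r = "reflect_poly (\<Prod>x\<in>#A. [:-x, 1:])"
    have "reflect_poly [:-y, 1:] = [:1, -y:]"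
      by (auto simp: reflect_poly_def)
    then have *: "reflect_poly (\<Prod>x\<in>#add_mset y A. [:-x, 1:]) = [:1, -y:] * ?r"
      by (simp add: reflect_poly_mult del: mult_pCons_left)
    define r' where "r' = reflect_poly (\<Prod>x\<in>#add_mset y A. [:-x, 1:])"
    have "coeff r' 0 = coeff ?r 0" "coeff r' 1 = coeff ?r 1 - y * coeff ?r 0"
      "coeff r' 2 = coeff ?r 2 - y * coeff ?r 1"
      unfolding r'_def * by (simp_all add: numeral_2_eq_2)
    with add have r': "coeff r' 0 = 1" "coeff r' 1 = - (y + (\<Sum>x\<in>#A. x))"
      "coeff r' 2 = coeff ?r 2 + y * (\<Sum>x\<in>#A. x)" by simp_all
    have "2 * coeff r' 2 = 2 * coeff ?r 2 + 2 * (y * (\<Sum>x\<in>#A. x))"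
      unfolding r'(3) by (rule distrib_left)
    also have "2 * coeff ?r 2 = (\<Sum>x\<in>#A. x)\<^sup>2 - (\<Sum>x\<in>#A. x\<^sup>2)"
      using add by simp
    also have "s\<^sup>2 - t + 2 * (y * s) = (y + s)\<^sup>2 - (y\<^sup>2 + t)" for s t :: 'a
      by (simp add: power2_eq_square algebra_simps)
    finally have "2 * coeff r' 2
        = (y + (\<Sum>x\<in>#A. x))\<^sup>2 - (y\<^sup>2 + (\<Sum>x\<in>#A. x\<^sup>2))" .
    then show ?case
      using r'(1,2) unfolding r'_def[symmetric] by simp
  qed
  then show "c 0 = 1" "c 1 = - (\<Sum>x\<in>#A. x)" "2 * c 2 = (\<Sum>x\<in>#A. x)\<^sup>2 - (\<Sum>x\<in>#A. x\<^sup>2)"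
    by auto
qed

definition root_power_sum :: "nat \<Rightarrow> complex poly \<Rightarrow> complex" where
  "root_power_sum d p = (\<Sum>x\<in>#proots p. x ^ d)"

lemma root_power_sum_mult:
  "p \<noteq> 0 \<Longrightarrow> q \<noteq> 0 \<Longrightarrow> root_power_sum d (p * q) = root_power_sum d p + root_power_sum d q"
  by (simp add: root_power_sum_def proots_mult)

lemma root_power_sum_0: "root_power_sum 0 p = of_nat (degree p)"
  by (simp add: root_power_sum_def size_proots_complex)

text \<open>Newton's identities p1 = e1 and p2 = e1^2 - 2 e2. Reversing the polynomial puts the
  elementary symmetric functions, up to sign, at the fixed indices 1 and 2, whatever the
  degree.\<close>

lemma root_power_sum_reflect_poly:
  assumes "lead_coeff p = 1"
  shows "root_power_sum 1 p = - coeff (reflect_poly p) 1"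
    "root_power_sum 2 p = (coeff (reflect_poly p) 1)\<^sup>2 - 2 * coeff (reflect_poly p) 2"
proof -
  have p: "(\<Prod>x\<in>#proots p. [:-x, 1:]) = p"
    using complex_poly_decompose_multiset[of p] assms by simp
  show "root_power_sum 1 p = - coeff (reflect_poly p) 1"
    "root_power_sum 2 p = (coeff (reflect_poly p) 1)\<^sup>2 - 2 * coeff (reflect_poly p) 2"
    using coeff_reflect_linear_factors(2,3)[of "proots p", unfolded p]
    by (simp_all add: root_power_sum_def)
qed

text \<open>Newton's identities up to order 2 involve only the three leading coefficients, so a
  perturbation further down, such as the remainder of a division, is invisible.\<close>

lemma root_power_sum_cong_top_coeffs:
  assumes "lead_coeff p = 1" "degree p = degree q" "d \<le> 2"
    "\<And>j. j \<le> degree p \<Longrightarrow> degree p \<le> j + 2 \<Longrightarrow> coeff p j = coeff q j"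
  shows "root_power_sum d p = root_power_sum d q"
proof -
  have q: "lead_coeff q = 1"
    using assms(1,2) assms(4)[of "degree p"] by simp
  have "coeff (reflect_poly p) j = coeff (reflect_poly q) j" if "j \<le> 2" for j
    using that assms(2) assms(4)[of "degree p - j"] by (auto simp: coeff_reflect_poly)
  moreover have "d = 0 \<or> d = 1 \<or> d = 2" using assms(3) by linarith
  ultimately show ?thesis
    using root_power_sum_reflect_poly[OF assms(1)] root_power_sum_reflect_poly[OF q] assms(2)
    by (auto simp: root_power_sum_0)
qed

lemma map_poly_of_real_mult:
  "map_poly complex_of_real (p * q) = map_poly of_real p * map_poly of_real q"
  by (rule poly_eqI) (simp add: coeff_map_poly coeff_mult)

text \<open>The division need not be exact: the remainder has degree below \<open>degree q\<close>, so it does not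
  reach the three leading coefficients of \<open>p\<close>.\<close>

lemma root_power_sum_div:
  fixes p q :: "real poly"
  assumes "lead_coeff p = 1" "lead_coeff q = 1" "degree q + 3 \<le> degree p" "d \<le> 2"
  defines "C \<equiv> map_poly complex_of_real"
  shows "root_power_sum d (C (p div q)) = root_power_sum d (C p) - root_power_sum d (C q)"
proof -
  let ?s = "p div q"
  have q0: "q \<noteq> 0" using assms(2) by auto
  have p0: "p \<noteq> 0" using assms(1) by auto
  have r: "p mod q = 0 \<or> degree (p mod q) < degree q"
    using degree_mod_less[OF q0] by auto
  have pe: "p = ?s * q + p mod q" by simp
  have s0: "?s \<noteq> 0"
    using assms(3) r pe by force
  have cf: "coeff p j = coeff (?s * q) j" if "degree q \<le> j" for j
  proof -
    have "coeff (p mod q) j = 0"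
      using r that by (auto intro: coeff_eq_0)
    then show ?thesis
      by (metis add.right_neutral coeff_add pe)
  qed
  have dg: "degree p = degree (?s * q)"
  proof (rule antisym)
    show "degree p \<le> degree (?s * q)"
      using cf[of "degree p"] assms(1,3) by (intro le_degree) auto
    have "degree q \<le> degree (?s * q)" using s0 q0 by (simp add: degree_mult_eq)
    then show "degree (?s * q) \<le> degree p"
      using cf[of "degree (?s * q)"] s0 q0
      by (intro le_degree) (metis leading_coeff_0_iff mult_eq_0_iff)
  qed
  have "root_power_sum d (C p) = root_power_sum d (C (?s * q))"
    using assms(1,3,4) dg cf
    by (intro root_power_sum_cong_top_coeffs) (auto simp: C_def coeff_map_poly degree_map_poly)
  also have "\<dots> = root_power_sum d (C ?s) + root_power_sum d (C q)"
    unfolding C_def map_poly_of_real_mult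
    by (rule root_power_sum_mult) (use s0 q0 in \<open>auto simp: map_poly_eq_0_iff\<close>)
  finally show ?thesis by simp
qed

section \<open>Power sums of eigenvalues as traces of matrix powers\<close>

lemma sum_diag_mult_commute:
  fixes A B :: "'a::comm_ring_1 mat"
  assumes "A \<in> carrier_mat n m" "B \<in> carrier_mat m n"
  shows "(\<Sum>i<n. (A * B) $$ (i, i)) = (\<Sum>i<m. (B * A) $$ (i, i))"
proof -
  have "(\<Sum>i<n. (A * B) $$ (i, i)) = (\<Sum>i<n. \<Sum>j<m. A $$ (i, j) * B $$ (j, i))"
    using assms by (simp add: scalar_prod_def atLeast0LessThan)
  also have "\<dots> = (\<Sum>j<m. \<Sum>i<n. B $$ (j, i) * A $$ (i, j))"
    by (subst sum.swap) (simp add: mult.commute)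
  also have "\<dots> = (\<Sum>i<m. (B * A) $$ (i, i))"
    using assms by (simp add: scalar_prod_def atLeast0LessThan)
  finally show ?thesis .
qed

lemma sum_diag_similar:
  fixes A B :: "'a::comm_ring_1 mat"
  assumes "A \<in> carrier_mat n n" "similar_mat_wit A B P Q"
  shows "(\<Sum>i<n. A $$ (i, i)) = (\<Sum>i<n. B $$ (i, i))"
proof -
  note w = similar_mat_witD2[OF assms]
  have "(\<Sum>i<n. (P * B * Q) $$ (i, i)) = (\<Sum>i<n. (Q * (P * B)) $$ (i, i))"
    using w by (intro sum_diag_mult_commute) auto
  also have "Q * (P * B) = B"
    using w assoc_mult_mat[of Q n n P n B n] by simp
  finally show ?thesis using w(3) by simp
qed

text \<open>Over the complex numbers a Schur decomposition makes \<open>A\<close> similar to an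
  upper triangular \<open>B\<close> with the roots on its diagonal. Then \<open>B * B\<close> has
  their squares on the diagonal, and diagonal sums are invariant under similarity.\<close>

lemma root_power_sum_char_poly:
  fixes A :: "complex mat"
  assumes A: "A \<in> carrier_mat n n"
  shows "root_power_sum 1 (char_poly A) = (\<Sum>i<n. A $$ (i, i))"
    "root_power_sum 2 (char_poly A) = (\<Sum>i<n. \<Sum>j<n. A $$ (i, j) * A $$ (j, i))"
proof -
  obtain es where cp: "char_poly A = (\<Prod>e\<leftarrow>es. [:- e, 1:])" and len: "length es = n"
    using char_poly_factorized[OF A] by blast
  have roots: "proots (char_poly A) = mset es"
    unfolding cp
  proof (induction es)
    case (Cons e es)
    have "(\<Prod>e\<leftarrow>es. [:- e, 1:]) \<noteq> 0" by (auto simp: prod_list_zero_iff)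
    then show ?case using Cons by (simp add: proots_mult del: mult_pCons_left)
  qed simp
  have rps: "root_power_sum d (char_poly A) = (\<Sum>i<n. (es ! i) ^ d)" for d
    using len mset_map[of "\<lambda>x. x ^ d" es, symmetric]
    by (simp add: root_power_sum_def roots sum_mset_sum_list sum_list_sum_nth atLeast0LessThan
      del: mset_map)
  obtain B P Q where "schur_decomposition A es = (B, P, Q)"
    by (metis prod_cases3)
  then have sim: "similar_mat_wit A B P Q" and ut: "upper_triangular B" and dB: "diag_mat B = es"
    using schur_decomposition[OF A cp] by blast+
  have B: "B \<in> carrier_mat n n"
    using similar_mat_witD2[OF A sim] by blast
  have Bii: "B $$ (i, i) = es ! i" if "i < n" for i
    using dB B that by (auto simp: diag_mat_def)
  show "root_power_sum 1 (char_poly A) = (\<Sum>i<n. A $$ (i, i))"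
    unfolding sum_diag_similar[OF A sim] rps using Bii by simp
  have sim2: "similar_mat_wit (A * A) (B * B) P Q"
    using similar_mat_wit_pow[OF sim, of 2] A B by (simp add: numeral_2_eq_2)
  \<comment> \<open>For distinct indices one of the two factors lies below the diagonal.\<close>
  have z: "B $$ (i, j) * B $$ (j, i) = (if i = j then (es ! i)\<^sup>2 else 0)" if "i < n" "j < n" for i j
    using ut B that Bii
    by (cases i j rule: linorder_cases) (auto simp: upper_triangular_def power2_eq_square)
  have "(\<Sum>i<n. \<Sum>j<n. A $$ (i, j) * A $$ (j, i)) = (\<Sum>i<n. (A * A) $$ (i, i))"
    using A by (simp add: scalar_prod_def atLeast0LessThan)
  also have "\<dots> = (\<Sum>i<n. (B * B) $$ (i, i))"
    by (rule sum_diag_similar[OF _ sim2]) (use A in auto)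
  also have "\<dots> = (\<Sum>i<n. \<Sum>j<n. B $$ (i, j) * B $$ (j, i))"
    using B by (simp add: scalar_prod_def atLeast0LessThan)
  also have "\<dots> = (\<Sum>i<n. (es ! i)\<^sup>2)"
    using z by (intro sum.cong) auto
  finally show "root_power_sum 2 (char_poly A) = (\<Sum>i<n. \<Sum>j<n. A $$ (i, j) * A $$ (j, i))"
    by (simp add: rps)
qed

text \<open>Macaulay matrices are indexed by monomials, while \<open>mat\<close> is indexed by
  numbers. A list mediates; when it is distinct, its order disappears from all traces.\<close>

definition list_mat :: "'b list \<Rightarrow> ('b \<Rightarrow> 'b \<Rightarrow> 'a) \<Rightarrow> 'a mat" where
  "list_mat xs f = mat (length xs) (length xs) (\<lambda>(r, c). f (xs ! r) (xs ! c))"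

lemma root_power_sum_list_mat:
  fixes f :: "'b \<Rightarrow> 'b \<Rightarrow> real"
  assumes "distinct xs"
  defines "p \<equiv> map_poly complex_of_real (char_poly (list_mat xs f))"
  shows "root_power_sum 0 p = of_nat (card (set xs))"
    "root_power_sum 1 p = of_real (\<Sum>a\<in>set xs. f a a)"
    "root_power_sum 2 p = of_real (\<Sum>a\<in>set xs. \<Sum>b\<in>set xs. f a b * f b a)"
proof -
  let ?n = "length xs" and ?A = "map_mat complex_of_real (list_mat xs f)"
  have A: "?A \<in> carrier_mat ?n ?n" and L: "list_mat xs f \<in> carrier_mat ?n ?n"
    by (auto simp: list_mat_def)
  have p: "p = char_poly ?A"
    unfolding p_def by (rule of_real_hom.char_poly_hom[OF L, symmetric])
  have nth: "(\<Sum>i<?n. g (xs ! i)) = (\<Sum>a\<in>set xs. g a)" for g :: "'b \<Rightarrow> complex"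
    using sum.reindex_bij_betw[OF bij_betw_nth[OF assms(1) refl refl], of g] .
  show "root_power_sum 0 p = of_nat (card (set xs))"
    using degree_monic_char_poly[OF A] distinct_card[OF assms(1)] by (simp add: p root_power_sum_0)
  have "root_power_sum 1 p = (\<Sum>i<?n. of_real (f (xs ! i) (xs ! i)))"
    unfolding p root_power_sum_char_poly[OF A] by (simp add: list_mat_def)
  then show "root_power_sum 1 p = of_real (\<Sum>a\<in>set xs. f a a)"
    using nth[of "\<lambda>a. of_real (f a a)"] by simp
  have "root_power_sum 2 p
      = (\<Sum>i<?n. \<Sum>j<?n. of_real (f (xs ! i) (xs ! j) * f (xs ! j) (xs ! i)))"
    unfolding p root_power_sum_char_poly[OF A] by (simp add: list_mat_def)
  also have "\<dots> = (\<Sum>a\<in>set xs. \<Sum>b\<in>set xs. of_real (f a b * f b a))"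
    using nth[of "\<lambda>a. \<Sum>j<?n. of_real (f a (xs ! j) * f (xs ! j) a)"]
      nth[of "\<lambda>b. of_real (f a b * f b a)" for a] by simp
  finally show "root_power_sum 2 p = of_real (\<Sum>a\<in>set xs. \<Sum>b\<in>set xs. f a b * f b a)"
    by simp
qed

section \<open>Traces of a tensor from the Macaulay matrices\<close>

lemma set_monomials: "set (monomials n N) = {a. size a = N \<and> set_mset a \<subseteq> {..<n}}"
proof (intro subset_antisym subsetI)
  fix a assume "a \<in> set (monomials n N)"
  then show "a \<in> {a. size a = N \<and> set_mset a \<subseteq> {..<n}}"
  proof -
    obtain xs where a: "a = mset xs" and "xs \<in> set (List.n_lists N [0..<n])"
      using \<open>a \<in> set (monomials n N)\<close> unfolding monomials_def set_map set_filter by blast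
    then have "length xs = N" "set xs \<subseteq> set [0..<n]"
      unfolding set_n_lists by blast+
    then show ?thesis unfolding a by (auto simp only: mem_Collect_eq size_mset set_mset_mset
          set_upt atLeastLessThan_iff lessThan_iff)
  qed
next
  fix a :: "nat multiset" assume a: "a \<in> {a. size a = N \<and> set_mset a \<subseteq> {..<n}}"
  let ?xs = "sorted_list_of_multiset a"
  have "length ?xs = N" "set ?xs \<subseteq> {..<n}"
    using a unfolding mem_Collect_eq size_mset[symmetric] set_mset_mset[symmetric]
      mset_sorted_list_of_multiset by blast+
  then have "?xs \<in> set (filter sorted (List.n_lists N [0..<n]))"
    unfolding set_filter set_n_lists
    by (auto simp only: mem_Collect_eq set_upt atLeastLessThan_iff lessThan_iff
        sorted_sorted_list_of_multiset)
  then have "mset ?xs \<in> set (monomials n N)"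
    unfolding monomials_def set_map by (rule imageI)
  then show "a \<in> set (monomials n N)" by simp
qed

lemma distinct_monomials: "distinct (monomials n N)"
proof -
  have "inj_on mset {xs :: nat list. sorted xs}"
    by (auto simp: inj_on_def) (metis properties_for_sort)
  then show ?thesis
    unfolding monomials_def distinct_map
    by (intro conjI distinct_filter distinct_n_lists distinct_upt)
      (erule inj_on_subset, auto)
qed

lemma finite_monomials: "finite {a. size a = N \<and> set_mset a \<subseteq> {..<n::nat}}"
  by (metis List.finite_set set_monomials)

lemma size_eq_sum_count:
  "set_mset a \<subseteq> {..<n::nat} \<Longrightarrow> size a = (\<Sum>i<n. count a i)"
  unfolding size_multiset_overloaded_eq
  by (rule sum.mono_neutral_left) (auto simp: not_in_iff)

text \<open>The variables whose \<open>D\<close>-th power divides the monomial: each row of the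
  numerator needs one of them, and the denominator keeps the rows with at least two.\<close>

definition heavy :: "nat \<Rightarrow> nat \<Rightarrow> nat multiset \<Rightarrow> nat set" where
  "heavy n D a = {i. i < n \<and> D \<le> count a i}"

text \<open>Pigeonhole: exponents of at most \<open>D - 1\<close> give total degree at most
  \<open>n * (D - 1)\<close>, one short of Macaulay's degree.\<close>

lemma heavy_nonempty:
  assumes "1 \<le> D" "size a = n * (D - 1) + 1" "set_mset a \<subseteq> {..<n}"
  shows "heavy n D a \<noteq> {}"
proof
  assume "heavy n D a = {}"
  then have "count a i \<le> D - 1" if "i < n" for i
    using that by (fastforce simp: heavy_def)
  then have "(\<Sum>i<n. count a i) \<le> (\<Sum>i<n. D - 1)"
    by (intro sum_mono) auto
  then show False
    using assms size_eq_sum_count[OF assms(3)] by simp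
qed

definition first_heavy :: "nat \<Rightarrow> nat multiset \<Rightarrow> nat" where
  "first_heavy D a = (LEAST i. D \<le> count a i)"

text \<open>The minimum ranges over all natural numbers, but any heavy index below \<open>n\<close>
  bounds it, so the row is assigned one of the \<open>n\<close> forms.\<close>

lemma first_heavy_in:
  assumes "heavy n D a \<noteq> {}"
  shows "first_heavy D a \<in> heavy n D a"
proof -
  obtain i where i: "i < n" "D \<le> count a i" using assms by (auto simp: heavy_def)
  then show ?thesis
    using LeastI[of "\<lambda>i. D \<le> count a i" i] Least_le[of "\<lambda>i. D \<le> count a i" i]
    by (auto simp: heavy_def first_heavy_def)
qed

section \<open>Macaulay matrices as characteristic matrices\<close>

definition form_coeff :: "nat \<Rightarrow> nat \<Rightarrow> tensor \<Rightarrow> nat \<Rightarrow> nat multiset \<Rightarrow> real" where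
  "form_coeff n D T i b = (\<Sum>\<gamma> | length \<gamma> = D \<and> set \<gamma> \<subseteq> {..<n} \<and> mset \<gamma> = b. T (i # \<gamma>))"

definition macaulay_coeff ::
    "nat \<Rightarrow> nat \<Rightarrow> tensor \<Rightarrow> nat multiset \<Rightarrow> nat multiset \<Rightarrow> real" where
  "macaulay_coeff n D T a b =
     (let i = first_heavy D a; c = a - replicate_mset D i
      in if c \<subseteq># b then form_coeff n D T i (b - c) else 0)"

text \<open>Row \<open>a\<close> is multiplied by the cofactor \<open>c\<close> with a = c x_i^D, so
  the term of the \<open>i\<close>-th form that carries the indeterminate, a multiple of x_i^D,
  lands in column \<open>a\<close> and in no other. Hence the Macaulay matrix is a characteristic
  matrix.\<close>

lemma macaulay_entry_char_form:
  assumes "heavy n (k - 1) a \<noteq> {}"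
  shows "macaulay_entry (k - 1) (char_form n k T) a b
    = (if a = b then [:0, 1:] else 0) - [:macaulay_coeff n (k - 1) T a b:]"
proof -
  let ?D = "k - 1"
  define i where "i = first_heavy ?D a"
  define c where "c = a - replicate_mset ?D i"
  have "?D \<le> count a i"
    using first_heavy_in[OF assms] by (simp add: i_def heavy_def)
  then have a: "a = c + replicate_mset ?D i"
    by (simp add: c_def count_le_replicate_mset_subset_eq)
  have "c \<subseteq># b \<and> b - c = replicate_mset ?D i \<longleftrightarrow> a = b"
    unfolding a by (auto simp: subset_mset.add_diff_inverse ac_simps)
      (metis add.commute subset_mset.add_diff_inverse)
  moreover have "c \<subseteq># a" unfolding c_def by simp
  moreover have "macaulay_entry ?D (char_form n k T) a b
      = (if c \<subseteq># b then char_form n k T i (b - c) else 0)"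
    unfolding macaulay_entry_def Let_def c_def i_def first_heavy_def ..
  moreover have "macaulay_coeff n ?D T a b = (if c \<subseteq># b then form_coeff n ?D T i (b - c) else 0)"
    unfolding macaulay_coeff_def Let_def c_def i_def ..
  ultimately show ?thesis
    by (auto simp: char_form_def form_coeff_def simp del: One_nat_def)
qed

lemma macaulay_det_char_form:
  assumes "distinct ms" "\<And>a. a \<in> set ms \<Longrightarrow> heavy n (k - 1) a \<noteq> {}"
  shows "macaulay_det (k - 1) (char_form n k T) ms
    = char_poly (list_mat ms (macaulay_coeff n (k - 1) T))"
proof -
  have "mat (length ms) (length ms)
      (\<lambda>(r, c). macaulay_entry (k - 1) (char_form n k T) (ms ! r) (ms ! c))
    = char_poly_matrix (list_mat ms (macaulay_coeff n (k - 1) T))"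
    using assms
    by (intro eq_matI)
      (auto simp: char_poly_matrix_def list_mat_def macaulay_entry_char_form nth_eq_iff_index_eq
        simp del: One_nat_def)
  then show ?thesis by (simp add: macaulay_det_def char_poly_def)
qed

definition all_monomials :: "nat \<Rightarrow> nat \<Rightarrow> nat multiset set" where
  "all_monomials n D = {a. size a = n * (D - 1) + 1 \<and> set_mset a \<subseteq> {..<n}}"

definition multi_heavy_monomials :: "nat \<Rightarrow> nat \<Rightarrow> nat multiset set" where
  "multi_heavy_monomials n D = {a \<in> all_monomials n D. 2 \<le> card (heavy n D a)}"

text \<open>The rows by which the numerator exceeds the denominator; their number is the difference
  of the degrees of the two determinants.\<close>

definition reduced_monomials :: "nat \<Rightarrow> nat \<Rightarrow> nat multiset set" where
  "reduced_monomials n D = {a \<in> all_monomials n D. is_singleton (heavy n D a)}"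

lemma finite_all_monomials: "finite (all_monomials n D)"
  by (simp add: all_monomials_def finite_monomials)

lemma finite_heavy: "finite (heavy n D a)"
  by (simp add: heavy_def)

lemma all_monomials_heavy: "1 \<le> D \<Longrightarrow> a \<in> all_monomials n D \<Longrightarrow> heavy n D a \<noteq> {}"
  using heavy_nonempty[of D a n] by (simp add: all_monomials_def)

lemma all_monomials_split:
  assumes "1 \<le> D"
  shows "all_monomials n D = reduced_monomials n D \<union> multi_heavy_monomials n D"
    "reduced_monomials n D \<inter> multi_heavy_monomials n D = {}"
proof -
  have "is_singleton (heavy n D a) \<longleftrightarrow> \<not> 2 \<le> card (heavy n D a)" if "a \<in> all_monomials n D" for a
  proof -
    have "card (heavy n D a) \<noteq> 0"
      using all_monomials_heavy[OF assms that] finite_heavy by simp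
    then show ?thesis unfolding is_singleton_altdef by linarith
  qed
  then show "all_monomials n D = reduced_monomials n D \<union> multi_heavy_monomials n D"
    "reduced_monomials n D \<inter> multi_heavy_monomials n D = {}"
    by (auto simp: reduced_monomials_def multi_heavy_monomials_def)
qed

text \<open>The bound 3 supplies the degree gap for \<open>root_power_sum_div\<close>. Diagonal
  terms cancel down to \<open>R\<close>. Off-diagonal ones do not: products pairing a monomial of
  \<open>R\<close> with one of \<open>S'\<close> occur in the numerator only, so their difference is
  left as it stands until the tensor is known.\<close>

lemma tensor_trace_macaulay:
  fixes T :: tensor
  assumes "2 \<le> k" "3 \<le> card (reduced_monomials n (k - 1))"
  defines "f \<equiv> macaulay_coeff n (k - 1) T"
    and "S \<equiv> all_monomials n (k - 1)" and "S' \<equiv> multi_heavy_monomials n (k - 1)"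
    and "R \<equiv> reduced_monomials n (k - 1)"
  shows "tensor_trace 0 n k T = card R"
    "tensor_trace 1 n k T = (\<Sum>a\<in>R. f a a)"
    "tensor_trace 2 n k T = (\<Sum>a\<in>R. (f a a)\<^sup>2)
      + ((\<Sum>a\<in>S. \<Sum>b\<in>S - {a}. f a b * f b a) - (\<Sum>a\<in>S'. \<Sum>b\<in>S' - {a}. f a b * f b a))"
proof -
  let ?D = "k - 1"
  define ms where "ms = monomials n (n * (?D - 1) + 1)"
  define ms' where "ms' = filter (\<lambda>a. 2 \<le> card (heavy n ?D a)) ms"
  have S: "set ms = S" "distinct ms" and S': "set ms' = S'" "distinct ms'"
    by (auto simp: ms_def ms'_def S_def S'_def set_monomials distinct_monomials all_monomials_def
        multi_heavy_monomials_def)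
  have hv: "heavy n ?D a \<noteq> {}" if "a \<in> S" for a
    using that all_monomials_heavy[of ?D] assms(1) unfolding S_def by auto
  have fin: "finite R" "finite S'" and un: "S = R \<union> S'" and disj: "R \<inter> S' = {}"
    using all_monomials_split[of ?D n] finite_all_monomials[of n ?D] assms(1)
    unfolding S_def S'_def R_def by (auto intro: finite_subset)
  have card: "card S = card R + card S'"
    unfolding un by (rule card_Un_disjoint) (use fin disj in auto)
  define p where "p = char_poly (list_mat ms f)"
  define q where "q = char_poly (list_mat ms' f)"
  define C where "C = map_poly complex_of_real"
  have mc: "list_mat xs f \<in> carrier_mat (length xs) (length xs)" for xs
    by (simp add: list_mat_def)
  have "tensor_char_poly n k T = p div q"
    unfolding tensor_char_poly_def resultant_def Let_def p_def q_def f_def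
      ms_def[symmetric] heavy_def[symmetric] ms'_def[symmetric]
    using macaulay_det_char_form[of ms n k T] macaulay_det_char_form[of ms' n k T] S S' hv un
    by auto
  then have tr: "tensor_trace d n k T = Re (root_power_sum d (C (p div q)))" for d
    by (simp add: tensor_trace_def eigenvalues_def root_power_sum_def C_def)
  have "root_power_sum d (C (p div q)) = root_power_sum d (C p) - root_power_sum d (C q)"
    if "d \<le> 2" for d
    unfolding C_def p_def q_def
    using degree_monic_char_poly[OF mc[of ms]] degree_monic_char_poly[OF mc[of ms']] that
      card assms(2) distinct_card[OF S(2)] distinct_card[OF S'(2)] S S'
    by (intro root_power_sum_div) (auto simp: R_def)
  then have tr: "tensor_trace d n k T = Re (root_power_sum d (C p) - root_power_sum d (C q))"
    if "d \<le> 2" for d using that tr by simp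
  note sums = root_power_sum_list_mat[OF S(2), of f] root_power_sum_list_mat[OF S'(2), of f]
  have split: "(\<Sum>a\<in>S. g a) = (\<Sum>a\<in>R. g a) + (\<Sum>a\<in>S'. g a)" for g :: "nat multiset \<Rightarrow> real"
    unfolding un by (rule sum.union_disjoint) (use fin disj in auto)
  show "tensor_trace 0 n k T = card R"
    using tr[of 0] sums card by (simp add: C_def p_def q_def S S')
  show "tensor_trace 1 n k T = (\<Sum>a\<in>R. f a a)"
    using tr[of 1] sums split by (simp add: C_def p_def q_def S S')
  have diag: "(\<Sum>a\<in>A. \<Sum>b\<in>A. f a b * f b a)
      = (\<Sum>a\<in>A. (f a a)\<^sup>2) + (\<Sum>a\<in>A. \<Sum>b\<in>A - {a}. f a b * f b a)" if "finite A" for A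
    unfolding sum.distrib[symmetric] using that
    by (intro sum.cong refl) (simp add: sum.remove power2_eq_square)
  have finS: "finite S" using fin un by simp
  have "tensor_trace 2 n k T
      = (\<Sum>a\<in>S. \<Sum>b\<in>S. f a b * f b a) - (\<Sum>a\<in>S'. \<Sum>b\<in>S'. f a b * f b a)"
    using tr[of 2] sums by (simp add: C_def p_def q_def S S')
  then show "tensor_trace 2 n k T = (\<Sum>a\<in>R. (f a a)\<^sup>2)
      + ((\<Sum>a\<in>S. \<Sum>b\<in>S - {a}. f a b * f b a) - (\<Sum>a\<in>S'. \<Sum>b\<in>S' - {a}. f a b * f b a))"
    unfolding diag[OF finS] diag[OF fin(2)] using split[of "\<lambda>a. (f a a)\<^sup>2"] by simp
qed

section \<open>Equal share of every variable in the reduced monomials\<close>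

definition reduced_at :: "nat \<Rightarrow> nat \<Rightarrow> nat \<Rightarrow> nat multiset set" where
  "reduced_at n D i = {a \<in> all_monomials n D. heavy n D a = {i}}"

text \<open>Swapping the variables \<open>i\<close> and \<open>j\<close> maps the monomials reduced at \<open>i\<close> to those reduced at
  \<open>j\<close>. Only this symmetry is needed, not the exact number \<open>D\<^sup>n\<^sup>-\<^sup>1\<close> of such monomials.\<close>

lemma card_reduced_at_le:
  assumes "i < n" "j < n"
  shows "card (reduced_at n D i) \<le> card (reduced_at n D j)"
proof -
  let ?t = "Transposition.transpose i j"
  have "count (image_mset ?t a) (?t x) = count a x" for a x
    by (induction a) (auto simp: inj_eq inj_transpose)
  from this[of _ "?t x" for x] have cnt: "count (image_mset ?t a) x = count a (?t x)" for a x
    by simp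
  have "image_mset ?t a \<in> reduced_at n D j" if "a \<in> reduced_at n D i" for a
  proof -
    have t: "?t x < n \<longleftrightarrow> x < n" for x
      using assms by (auto simp: transpose_def)
    have "heavy n D (image_mset ?t a) = ?t ` heavy n D a"
      by (intro subset_antisym subsetI) (simp_all add: in_transpose_image_iff heavy_def cnt t)
    then show ?thesis
      using that t by (auto simp: reduced_at_def all_monomials_def)
  qed
  then show ?thesis
    by (intro card_inj_on_le[where f = "image_mset ?t"] inj_on_inverseI[where g = "image_mset ?t"])
      (auto simp: reduced_at_def finite_all_monomials multiset.map_comp)
qed

lemma card_reduced_at:
  "i < n \<Longrightarrow> card (reduced_at n D i) = card (reduced_at n D 0)"
  by (intro antisym card_reduced_at_le) auto

lemma reduced_at_nonempty:
  assumes "1 \<le> D" "i < n"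
  shows "reduced_at n D i \<noteq> {}"
proof -
  \<comment> \<open>Exponent \<open>D\<close> at \<open>i\<close> and \<open>D - 1\<close>
    elsewhere: this sums to exactly \<open>n * (D - 1) + 1\<close> and makes \<open>i\<close> the
    only heavy variable.\<close>
  define a where "a = Abs_multiset (\<lambda>j. if j < n then (if j = i then D else D - 1) else 0)"
  have "finite {j. 0 < (if j < n then (if j = i then D else D - 1) else 0)}"
    by (rule finite_subset[of _ "{..<n}"]) auto
  then have cnt: "count a j = (if j < n then (if j = i then D else D - 1) else 0)" for j
    unfolding a_def by (subst count_Abs_multiset) auto
  have sub: "set_mset a \<subseteq> {..<n}"
    by (metis cnt lessThan_iff not_in_iff subsetI)
  have "size a = (\<Sum>j<n. (D - 1) + (if j = i then 1 else 0))"
    unfolding size_eq_sum_count[OF sub] using assms by (intro sum.cong) (auto simp: cnt)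
  also have "\<dots> = n * (D - 1) + 1"
    unfolding sum.distrib using assms by simp
  finally have "a \<in> reduced_at n D i"
    using sub assms by (auto simp: reduced_at_def all_monomials_def heavy_def cnt split: if_splits)
  then show ?thesis by blast
qed

lemma card_reduced_at_pos:
  assumes "1 \<le> D" "i < n"
  shows "0 < card (reduced_at n D i)"
  using reduced_at_nonempty[OF assms] finite_all_monomials[of n D]
  by (simp add: reduced_at_def card_gt_0_iff)

text \<open>The reduced monomials split into the classes \<open>reduced_at n D i\<close>, all of the
  same size, and on each class the row's variable is constantly \<open>i\<close>.\<close>

lemma sum_reduced_monomials:
  fixes g :: "nat \<Rightarrow> real"
  shows "(\<Sum>a\<in>reduced_monomials n D. g (first_heavy D a))
    = real (card (reduced_at n D 0)) * (\<Sum>i<n. g i)"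
proof -
  have fin: "finite (reduced_at n D i)" for i
    using finite_all_monomials[of n D] by (simp add: reduced_at_def)
  have "reduced_monomials n D = (\<Union>i<n. reduced_at n D i)"
    by (auto simp: reduced_monomials_def reduced_at_def is_singleton_def heavy_def)
  moreover have "reduced_at n D i \<inter> reduced_at n D j = {}" if "i \<noteq> j" for i j
    using that by (auto simp: reduced_at_def)
  ultimately have "(\<Sum>a\<in>reduced_monomials n D. g (first_heavy D a))
      = (\<Sum>i<n. \<Sum>a\<in>reduced_at n D i. g (first_heavy D a))"
    using fin by (simp add: sum.UNION_disjoint)
  also have "\<dots> = (\<Sum>i<n. \<Sum>a\<in>reduced_at n D i. g i)"
    using first_heavy_in by (intro sum.cong refl) (fastforce simp: reduced_at_def)
  also have "\<dots> = (\<Sum>i<n. real (card (reduced_at n D 0)) * g i)"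
    by (intro sum.cong refl) (metis card_reduced_at lessThan_iff sum_constant)
  finally show ?thesis by (simp add: sum_distrib_left)
qed

section \<open>Traces of the \<open>\<alpha>\<close>-tensor\<close>

lemma mset_eq_replicate_iff: "mset xs = replicate_mset n x \<longleftrightarrow> xs = replicate n x"
proof
  assume *: "mset xs = replicate_mset n x"
  show "xs = replicate n x"
  proof (rule replicate_eqI)
    show "length xs = n" using arg_cong[OF *, of size] by simp
    show "y = x" if "y \<in> set xs" for y
      using arg_cong[OF *, of set_mset] that by (auto split: if_splits)
  qed
qed simp

lemma singleton_not_edge: "uniform k H \<Longrightarrow> 2 \<le> k \<Longrightarrow> {i} \<notin> hyperedges H"
  by (auto simp: uniform_def)

lemma form_coeff_alpha_diag:
  assumes "2 \<le> k" "uniform k H" "i < n"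
  shows "form_coeff n (k - 1) (alpha_tensor \<alpha> k H) i (replicate_mset (k - 1) i)
    = \<alpha> * real (vertex_degree H i)"
proof -
  have "{\<gamma>. length \<gamma> = k - 1 \<and> set \<gamma> \<subseteq> {..<n} \<and> mset \<gamma> = replicate_mset (k - 1) i}
      = {replicate (k - 1) i}"
    unfolding mset_eq_replicate_iff using assms by auto
  moreover have "i # replicate (k - 1) i = replicate k i"
    using assms by (cases k) auto
  moreover have "set (replicate k i) = {i}" using assms by simp
  ultimately show ?thesis
    using singleton_not_edge[OF assms(2,1)] assms(1)
    by (simp add: form_coeff_def alpha_tensor_def degree_tensor_def adjacency_tensor_def)
qed

text \<open>Away from the constant index list only the adjacency tensor contributes. Its
  \<open>k\<close> indices must fill a hyperedge of \<open>k\<close> vertices, so they are distinct: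
  the monomial is squarefree and free of x_i.\<close>

lemma form_coeff_alpha_offdiag:
  assumes "2 \<le> k" "uniform k H" "b \<noteq> replicate_mset (k - 1) i"
    and "form_coeff n (k - 1) (alpha_tensor \<alpha> k H) i b \<noteq> 0"
  shows "i \<notin># b" "count b x \<le> 1"
proof -
  obtain \<gamma> where \<gamma>: "length \<gamma> = k - 1" "mset \<gamma> = b" "alpha_tensor \<alpha> k H (i # \<gamma>) \<noteq> 0"
    using assms(4) unfolding form_coeff_def by (auto elim: sum.not_neutral_contains_not_neutral)
  have "i # \<gamma> \<noteq> replicate k i"
    using assms(1,3) \<gamma>(2) by (cases k) auto
  then have "set (i # \<gamma>) \<in> hyperedges H"
    using \<gamma>(3) by (auto simp: alpha_tensor_def degree_tensor_def adjacency_tensor_def split: if_splits)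
  then have "card (set (i # \<gamma>)) = length (i # \<gamma>)"
    using assms(1,2) \<gamma>(1) unfolding uniform_def by auto
  then have d: "distinct (i # \<gamma>)" by (rule card_distinct)
  then show "i \<notin># b" unfolding \<gamma>(2)[symmetric] by simp
  show "count b x \<le> 1"
    using d distinct_count_atmost_1[of \<gamma>] unfolding \<gamma>(2)[symmetric] by auto
qed

lemma macaulay_coeff_alpha_diag:
  assumes "2 \<le> k" "uniform k H" "heavy n (k - 1) a \<noteq> {}"
  shows "macaulay_coeff n (k - 1) (alpha_tensor \<alpha> k H) a a
    = \<alpha> * real (vertex_degree H (first_heavy (k - 1) a))"
proof -
  let ?i = "first_heavy (k - 1) a"
  have i: "?i < n" "k - 1 \<le> count a ?i"
    using first_heavy_in[OF assms(3)] by (auto simp: heavy_def)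
  have "a - (a - replicate_mset (k - 1) ?i) = replicate_mset (k - 1) ?i"
    by (rule multiset_eqI) (use i(2) in auto)
  then show ?thesis
    using form_coeff_alpha_diag[OF assms(1,2) i(1)]
    by (simp add: macaulay_coeff_def Let_def del: One_nat_def)
qed

text \<open>If both entries were nonzero, with \<open>i\<close>, \<open>j\<close> the rows' variables, then
  \<open>x\<^sub>i\<^sup>k\<^sup>-\<^sup>1 x\<^sub>j\<^sup>k\<^sup>-\<^sup>1\<close> would be a product of two squarefree monomials, the first free of \<open>x\<^sub>i\<close>
  and the second free of \<open>x\<^sub>j\<close>; comparing exponents of \<open>x\<^sub>i\<close> excludes this for \<open>k \<ge> 3\<close>.\<close>

lemma macaulay_coeff_alpha_offdiag:
  fixes \<alpha> :: real and H :: hypergraph and k n :: nat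
  defines "f \<equiv> macaulay_coeff n (k - 1) (alpha_tensor \<alpha> k H)"
  assumes k: "3 \<le> k" and H: "uniform k H" and "a \<noteq> b"
    and ha: "heavy n (k - 1) a \<noteq> {}" and hb: "heavy n (k - 1) b \<noteq> {}"
  shows "f a b * f b a = 0"
proof (rule ccontr)
  let ?T = "alpha_tensor \<alpha> k H" and ?D = "k - 1"
  have decomp: "\<exists>c m. x = c + replicate_mset ?D (first_heavy ?D x) \<and> y = c + m \<and>
      first_heavy ?D x \<notin># m \<and> (\<forall>z. count m z \<le> 1)"
    if xy: "f x y \<noteq> 0" "x \<noteq> y" and h: "heavy n ?D x \<noteq> {}" for x y
  proof -
    define i where "i = first_heavy ?D x"
    define c where "c = x - replicate_mset ?D i"
    have x: "x = c + replicate_mset ?D i"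
      using first_heavy_in[OF h] unfolding c_def
      by (simp add: heavy_def i_def count_le_replicate_mset_subset_eq)
    have fxy: "f x y = (if c \<subseteq># y then form_coeff n ?D ?T i (y - c) else 0)"
      unfolding f_def macaulay_coeff_def Let_def c_def i_def ..
    then have c: "c \<subseteq># y" and fc: "form_coeff n ?D ?T i (y - c) \<noteq> 0"
      using xy(1) by (auto split: if_splits)
    have y: "y = c + (y - c)" using c by simp
    have ne: "y - c \<noteq> replicate_mset ?D i"
      using x y xy(2) by metis
    have "i \<notin># y - c" "\<forall>z. count (y - c) z \<le> 1"
      using form_coeff_alpha_offdiag[OF _ H ne fc] k by auto
    then show ?thesis
      using x y unfolding i_def[symmetric] by blast
  qed
  assume "f a b * f b a \<noteq> 0"
  then have "f a b \<noteq> 0" "f b a \<noteq> 0" by auto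
  let ?i = "first_heavy ?D a" and ?j = "first_heavy ?D b"
  obtain c m where 1: "a = c + replicate_mset ?D ?i" "b = c + m" "?i \<notin># m"
    using decomp[OF \<open>f a b \<noteq> 0\<close> assms(4) ha] by blast
  obtain c' m' where 2: "b = c' + replicate_mset ?D ?j" "a = c' + m'" "?j \<notin># m'"
      "\<forall>z. count m' z \<le> 1"
    using decomp[OF \<open>f b a \<noteq> 0\<close> assms(4)[symmetric] hb] by blast
  \<comment> \<open>Combined, the three counts below force the exponent of the variable
    \<open>?i\<close> in \<open>m'\<close> to be at least \<open>k - 1\<close>, which exceeds
    1.\<close>
  have a: "count a ?i = count b ?i + ?D"
    using arg_cong[OF 1(1), of "\<lambda>x. count x ?i"] arg_cong[OF 1(2), of "\<lambda>x. count x ?i"] 1(3)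
    by (simp add: not_in_iff)
  have b: "count b ?i = count c' ?i + (if ?j = ?i then ?D else 0)"
    using arg_cong[OF 2(1), of "\<lambda>x. count x ?i"] by simp
  have a': "count a ?i = count c' ?i + count m' ?i"
    using arg_cong[OF 2(2), of "\<lambda>x. count x ?i"] by simp
  have "count m' ?i \<le> 1" "?j = ?i \<longrightarrow> count m' ?i = 0"
    using 2(3,4) by (auto simp: not_in_iff)
  then show False
    using a b a' k by auto
qed

section \<open>The graph case k = 2\<close>

lemma all_monomials_1: "all_monomials n 1 = (\<lambda>i. {#i#}) ` {..<n}"
proof -
  have "x \<in> all_monomials n 1 \<longleftrightarrow> (\<exists>i<n. x = {#i#})" for x
    using size_1_singleton_mset[of x] by (auto simp: all_monomials_def)
  then show ?thesis by blast
qed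

lemma first_heavy_single: "first_heavy 1 {#i#} = i"
  unfolding first_heavy_def by (rule Least_equality) (auto split: if_splits)

text \<open>For k = 2 Macaulay's degree is 1 and rows and columns are the vertices: off the diagonal
  the matrix is (1 - \<alpha>) times the ordinary adjacency matrix of the graph.\<close>

lemma macaulay_coeff_alpha_graph:
  assumes "uniform 2 H" "i \<noteq> j" "j < n"
  shows "macaulay_coeff n 1 (alpha_tensor \<alpha> 2 H) {#i#} {#j#}
    = (1 - \<alpha>) * of_bool ({i, j} \<in> hyperedges H)"
proof -
  have "{\<gamma>. length \<gamma> = 1 \<and> set \<gamma> \<subseteq> {..<n} \<and> mset \<gamma> = {#j#}} = {[j]}"
    using assms by auto
  then have "form_coeff n 1 (alpha_tensor \<alpha> 2 H) i {#j#} = alpha_tensor \<alpha> 2 H [i, j]"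
    by (simp add: form_coeff_def)
  then show ?thesis
    using assms(2) unfolding macaulay_coeff_def Let_def first_heavy_single
    by (simp add: alpha_tensor_def degree_tensor_def adjacency_tensor_def numeral_2_eq_2)
qed

lemma vertex_degree_graph:
  assumes "uniform 2 H" "hypergraph H" "i < nverts H"
  shows "vertex_degree H i = card {j \<in> {..<nverts H} - {i}. {i, j} \<in> hyperedges H}"
proof -
  have "bij_betw (\<lambda>j. {i, j}) {j \<in> {..<nverts H} - {i}. {i, j} \<in> hyperedges H}
      {e \<in> hyperedges H. i \<in> e}"
  proof (rule bij_betwI')
    fix e assume e: "e \<in> {e \<in> hyperedges H. i \<in> e}"
    then have "card e = 2" using assms(1) by (auto simp: uniform_def)
    then obtain j where "e = {i, j}" "i \<noteq> j"
      using e by (auto simp: card_2_iff)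
    then show "\<exists>j\<in>{j \<in> {..<nverts H} - {i}. {i, j} \<in> hyperedges H}. e = {i, j}"
      using e assms(2) by (auto simp: hypergraph_def)
  qed (auto simp: doubleton_eq_iff)
  then show ?thesis
    unfolding vertex_degree_def by (rule bij_betw_same_card[symmetric])
qed

text \<open>The factor \<open>c\<close> is the number of reduced rows of each vertex. It depends on
  \<open>n\<close> and \<open>k\<close> only, so on a common vertex set these traces are compared
  through degrees alone.\<close>

lemma tensor_trace_alpha:
  assumes k: "2 \<le> k" and n: "3 \<le> n" and H: "uniform k H" "hypergraph H" "nverts H = n"
  defines "c \<equiv> real (card (reduced_at n (k - 1) 0))"
  shows "tensor_trace 0 n k (alpha_tensor \<alpha> k H) = c * real n"
    "tensor_trace 1 n k (alpha_tensor \<alpha> k H) = c * \<alpha> * (\<Sum>i<n. real (vertex_degree H i))"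
    "tensor_trace 2 n k (alpha_tensor \<alpha> k H) = c * \<alpha>\<^sup>2 * (\<Sum>i<n. (real (vertex_degree H i))\<^sup>2)
      + (if k = 2 then (1 - \<alpha>)\<^sup>2 * (\<Sum>i<n. real (vertex_degree H i)) else 0)"
proof -
  let ?D = "k - 1"
  let ?R = "reduced_monomials n ?D" and ?S = "all_monomials n ?D"
    and ?S' = "multi_heavy_monomials n ?D"
  define f where "f = macaulay_coeff n ?D (alpha_tensor \<alpha> k H)"
  have cR: "real (card ?R) = c * real n"
    using sum_reduced_monomials[of "\<lambda>_. 1" ?D n] by (simp add: c_def)
  have D: "1 \<le> ?D" and "0 < n" using k n by linarith+
  \<comment> \<open>At least one reduced monomial for each of the \<open>n\<close> \<ge> 3 vertices
    secures the required degree gap.\<close>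
  then have "1 \<le> card (reduced_at n ?D 0)"
    using card_reduced_at_pos[OF D \<open>0 < n\<close>] by linarith
  then have "1 * real n \<le> real (card ?R)"
    unfolding cR c_def by (intro mult_right_mono) auto
  then have R: "3 \<le> card ?R" using n by linarith
  note tr = tensor_trace_macaulay[OF k R, of "alpha_tensor \<alpha> k H", folded f_def]
  have hv: "heavy n ?D a \<noteq> {}" if "a \<in> ?S" for a
    using all_monomials_heavy[OF D that] .
  have faa: "f a a = \<alpha> * real (vertex_degree H (first_heavy ?D a))" if "a \<in> ?R" for a
    unfolding f_def by (rule macaulay_coeff_alpha_diag[OF k H(1) hv])
      (use that in \<open>simp add: reduced_monomials_def\<close>)
  show "tensor_trace 0 n k (alpha_tensor \<alpha> k H) = c * real n"
    using tr(1) cR by simp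
  show "tensor_trace 1 n k (alpha_tensor \<alpha> k H) = c * \<alpha> * (\<Sum>i<n. real (vertex_degree H i))"
    unfolding tr(2) using sum_reduced_monomials[of "\<lambda>i. \<alpha> * real (vertex_degree H i)" ?D n]
    by (simp add: faa c_def sum_distrib_left[symmetric] mult_ac)
  have diag: "(\<Sum>a\<in>?R. (f a a)\<^sup>2) = c * \<alpha>\<^sup>2 * (\<Sum>i<n. (real (vertex_degree H i))\<^sup>2)"
    using sum_reduced_monomials[of "\<lambda>i. (\<alpha> * real (vertex_degree H i))\<^sup>2" ?D n]
    by (simp add: faa c_def sum_distrib_left mult_ac power_mult_distrib)
  have off: "(\<Sum>a\<in>?S. \<Sum>b\<in>?S - {a}. f a b * f b a) - (\<Sum>a\<in>?S'. \<Sum>b\<in>?S' - {a}. f a b * f b a)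
    = (if k = 2 then (1 - \<alpha>)\<^sup>2 * (\<Sum>i<n. real (vertex_degree H i)) else 0)"
  proof (cases "k = 2")
    case False
    have z: "f a b * f b a = 0" if "a \<in> ?S" "b \<in> ?S" "a \<noteq> b" for a b
      unfolding f_def
      by (rule macaulay_coeff_alpha_offdiag[OF _ H(1) that(3) hv hv]) (use k False that in auto)
    have "?S' \<subseteq> ?S" by (auto simp: multi_heavy_monomials_def)
    then have "(\<Sum>a\<in>?S'. \<Sum>b\<in>?S' - {a}. f a b * f b a) = 0"
      using z by (intro sum.neutral ballI) blast
    moreover have "(\<Sum>a\<in>?S. \<Sum>b\<in>?S - {a}. f a b * f b a) = 0"
      using z by (intro sum.neutral ballI) blast
    ultimately show ?thesis using False by simp
  next
    case True
    then have D1: "?D = 1" by simp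
    \<comment> \<open>A monomial of degree 1 has no two heavy variables, so the denominator is an
      empty determinant.\<close>
    have "heavy n 1 {#i#} \<subseteq> {i}" for i
      by (auto simp: heavy_def split: if_splits)
    then have "card (heavy n 1 {#i#}) \<le> 1" for i
      using card_mono[of "{i}" "heavy n 1 {#i#}"] by simp
    then have "\<not> 2 \<le> card (heavy n 1 {#i#})" for i
      by (metis Suc_1 not_less_eq_eq)
    then have "?S' = {}"
      unfolding multi_heavy_monomials_def D1 all_monomials_1 by blast
    moreover have "(\<Sum>a\<in>?S. \<Sum>b\<in>?S - {a}. f a b * f b a)
        = (\<Sum>i<n. \<Sum>j\<in>{..<n} - {i}. f {#i#} {#j#} * f {#j#} {#i#})"
    proof -
      have "?S - {{#i#}} = (\<lambda>i. {#i#}) ` ({..<n} - {i})" for i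
        unfolding D1 all_monomials_1 by auto
      then show ?thesis
        unfolding D1 all_monomials_1 by (simp add: sum.reindex inj_on_def)
    qed
    moreover have "(\<Sum>j\<in>{..<n} - {i}. f {#i#} {#j#} * f {#j#} {#i#})
        = (1 - \<alpha>)\<^sup>2 * real (vertex_degree H i)" if "i < n" for i
    proof -
      have "(\<Sum>j\<in>{..<n} - {i}. f {#i#} {#j#} * f {#j#} {#i#})
          = (\<Sum>j\<in>{..<n} - {i}. (1 - \<alpha>)\<^sup>2 * of_bool ({i, j} \<in> hyperedges H))"
        using H(1) that True macaulay_coeff_alpha_graph[of H] unfolding f_def D1
        by (intro sum.cong refl) (auto simp: power2_eq_square insert_commute)
      also have "\<dots> = (1 - \<alpha>)\<^sup>2 * real (card {j \<in> {..<n} - {i}. {i, j} \<in> hyperedges H})"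
        by (simp add: sum_distrib_left[symmetric] sum.inter_filter[symmetric] of_bool_def)
      finally show ?thesis
        using vertex_degree_graph[of H i] H that True by simp
    qed
    ultimately show ?thesis using True by (simp add: sum_distrib_left)
  qed
  show "tensor_trace 2 n k (alpha_tensor \<alpha> k H) = c * \<alpha>\<^sup>2 * (\<Sum>i<n. (real (vertex_degree H i))\<^sup>2)
      + (if k = 2 then (1 - \<alpha>)\<^sup>2 * (\<Sum>i<n. real (vertex_degree H i)) else 0)"
    unfolding tr(3) diag off ..
qed

section \<open>Hypertrees\<close>

definition joined :: "nat set set \<Rightarrow> (nat \<times> nat) set" where
  "joined F = {(x, y). \<exists>e\<in>F. x \<in> e \<and> y \<in> e}"

lemma joined_sym: "(x, y) \<in> (joined F)\<^sup>* \<Longrightarrow> (y, x) \<in> (joined F)\<^sup>*"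
  by (rule symD[OF sym_rtrancl]) (auto simp: sym_def joined_def)

text \<open>Minimal length excludes repeated vertices and shortcuts. The latter makes the hyperedges
  along the walk distinct: one used at steps \<open>i\<close> < \<open>j\<close> would join
  \<open>f i\<close> directly to \<open>f (Suc j)\<close>.\<close>

lemma shortest_walk:
  assumes "(u, v) \<in> R\<^sup>*"
  obtains l f where "f (0::nat) = u" "f l = v" "\<And>i. i < l \<Longrightarrow> (f i, f (Suc i)) \<in> R"
    "\<And>i j. i \<le> j \<Longrightarrow> j \<le> l \<Longrightarrow> f i = f j \<Longrightarrow> i = j"
    "\<And>i j. i < j \<Longrightarrow> j < l \<Longrightarrow> (f i, f (Suc j)) \<notin> R"
proof -
  define l where "l = (LEAST l. (u, v) \<in> R ^^ l)"
  have l: "(u, v) \<in> R ^^ l"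
    unfolding l_def using assms by (metis LeastI rtrancl_imp_relpow)
  have short: "(u, v) \<notin> R ^^ l'" if "l' < l" for l'
    using that not_less_Least unfolding l_def by blast
  obtain f where f: "f 0 = u" "f l = v" "\<And>i. i < l \<Longrightarrow> (f i, f (Suc i)) \<in> R"
    using l unfolding relpow_fun_conv by blast
  have sub: "(f a, f b) \<in> R ^^ (b - a)" if "a \<le> b" "b \<le> l" for a b
    unfolding relpow_fun_conv using that f(3) by (intro exI[of _ "\<lambda>i. f (a + i)"]) auto
  have "i = j" if "i \<le> j" "j \<le> l" "f i = f j" for i j
  proof (rule ccontr)
    assume "i \<noteq> j"
    have "(u, v) \<in> R ^^ (i + (l - j))"
      unfolding relpow_add using sub[of 0 i] sub[of j l] that f(1,2) by auto
    moreover have "i + (l - j) < l" using \<open>i \<noteq> j\<close> that by linarith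
    ultimately show False using short by blast
  qed
  moreover have "(f i, f (Suc j)) \<notin> R" if "i < j" "j < l" for i j
  proof
    assume r: "(f i, f (Suc j)) \<in> R"
    have "(u, f i) \<in> R ^^ i" "(f (Suc j), v) \<in> R ^^ (l - Suc j)"
      using sub[of 0 i] sub[of "Suc j" l] that f(1,2) by auto
    then have "(u, v) \<in> R ^^ (Suc i + (l - Suc j))"
      unfolding relpow_add using r by auto
    moreover have "Suc i + (l - Suc j) < l" using that by linarith
    ultimately show False using short by blast
  qed
  ultimately show thesis using that f by blast
qed

text \<open>A shortest walk from \<open>u\<close> to \<open>v\<close> inside \<open>F\<close> is
  closed by \<open>e\<close>, which differs from all hyperedges of the walk because it lies outside
  \<open>F\<close>.\<close>

lemma cycle_of_joined:
  assumes "F \<subseteq> hyperedges H" "e \<in> hyperedges H - F" "u \<in> e" "v \<in> e" "u \<noteq> v"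
    and "(u, v) \<in> (joined F)\<^sup>*"
  shows "\<exists>vs es. is_cycle H vs es"
proof -
  obtain l f where f: "f 0 = u" "f l = v" "\<And>i. i < l \<Longrightarrow> (f i, f (Suc i)) \<in> joined F"
    and inj: "\<And>i j. i \<le> j \<Longrightarrow> j \<le> l \<Longrightarrow> f i = f j \<Longrightarrow> i = j"
    and chord: "\<And>i j. i < j \<Longrightarrow> j < l \<Longrightarrow> (f i, f (Suc j)) \<notin> joined F"
    by (rule shortest_walk[OF assms(6)], rule that)
  have "\<forall>i. \<exists>e. i < l \<longrightarrow> e \<in> F \<and> f i \<in> e \<and> f (Suc i) \<in> e"
    using f(3) by (auto simp: joined_def)
  then obtain g where g: "\<And>i. i < l \<Longrightarrow> g i \<in> F \<and> f i \<in> g i \<and> f (Suc i) \<in> g i"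
    by metis
  have l: "0 < l" using f(1,2) assms(5) by (cases l) auto
  have ginj: "g i \<noteq> g j" if "i < j" "j < l" for i j
    using chord[OF that] g[of i] g[of j] that by (auto simp: joined_def)
  let ?vs = "map f [0..<Suc l]" and ?es = "map g [0..<l] @ [e]"
  have "inj_on f {0..<Suc l}"
  proof (rule inj_onI)
    fix i j assume "i \<in> {0..<Suc l}" "j \<in> {0..<Suc l}" "f i = f j"
    then show "i = j" using inj[of i j] inj[of j i] by (cases "i \<le> j") auto
  qed
  moreover have "inj_on g {0..<l}"
  proof (rule inj_onI)
    fix i j assume "i \<in> {0..<l}" "j \<in> {0..<l}" "g i = g j"
    then show "i = j" using ginj[of i j] ginj[of j i] by (cases i j rule: linorder_cases) auto
  qed
  moreover have "e \<notin> g ` {0..<l}" using g assms(2) by auto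
  moreover have "?vs ! i \<in> ?es ! i \<and> ?vs ! (Suc i mod length ?es) \<in> ?es ! i"
    if "i < length ?es" for i
  proof (cases "i < l")
    case True
    then show ?thesis using g[of i] by (simp add: nth_append del: upt_Suc)
  next
    case False
    then have "i = l" using that by simp
    then show ?thesis using f assms(3,4) by (simp add: nth_append del: upt_Suc)
  qed
  moreover have "set ?es \<subseteq> hyperedges H" using g assms(1,2) by auto
  ultimately have "is_cycle H ?vs ?es"
    unfolding is_cycle_def using l by (simp add: distinct_map del: upt_Suc)
  then show ?thesis by blast
qed

section \<open>Intersections of hyperedges\<close>

lemma hypertree_edges_meet_once:
  assumes "hypertree H" "e \<in> hyperedges H" "e' \<in> hyperedges H" "e \<noteq> e'"
    and "u \<in> e" "u \<in> e'" "v \<in> e" "v \<in> e'"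
  shows "u = v"
proof (rule ccontr)
  assume "u \<noteq> v"
  then have "is_cycle H [u, v] [e, e']"
    using assms by (auto simp: is_cycle_def less_Suc_eq)
  then show False using assms(1) by (auto simp: hypertree_def)
qed

lemma finite_hyperedges: "hypergraph H \<Longrightarrow> finite (hyperedges H)"
  unfolding hypergraph_def by (rule finite_subset) auto

lemma finite_hyperedge: "hypergraph H \<Longrightarrow> e \<in> hyperedges H \<Longrightarrow> finite e"
  unfolding hypergraph_def by (auto intro: finite_subset)

lemma hypertree_card_inter_le:
  assumes "hypertree H" "e \<in> hyperedges H" "e' \<in> hyperedges H" "e \<noteq> e'"
  shows "card (e \<inter> e') \<le> 1"
proof -
  have "finite (e \<inter> e')"
    using assms finite_hyperedge by (auto simp: hypertree_def)
  then show ?thesis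
    using hypertree_edges_meet_once[OF assms] by (auto simp: card_le_Suc0_iff_eq)
qed

text \<open>The Helly property of subtrees, for hyperedges.\<close>

lemma hypertree_intersecting_imp_common:
  assumes H: "hypertree H" and ne: "hyperedges H \<noteq> {}" "{} \<notin> hyperedges H"
    and meet: "\<And>e e'. e \<in> hyperedges H \<Longrightarrow> e' \<in> hyperedges H \<Longrightarrow> e \<inter> e' \<noteq> {}"
  shows "\<exists>c. \<forall>e\<in>hyperedges H. c \<in> e"
proof (cases "\<exists>e1\<in>hyperedges H. \<exists>e2\<in>hyperedges H. e1 \<noteq> e2")
  case False
  then show ?thesis using ne by (metis all_not_in_conv)
next
  case True
  then obtain e1 e2 where e: "e1 \<in> hyperedges H" "e2 \<in> hyperedges H" "e1 \<noteq> e2" by blast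
  obtain c where c: "c \<in> e1" "c \<in> e2" using meet[OF e(1,2)] by blast
  have "c \<in> e3" if e3: "e3 \<in> hyperedges H" for e3
  proof (rule ccontr)
    assume n: "c \<notin> e3"
    obtain a b where ab: "a \<in> e3" "a \<in> e1" "b \<in> e2" "b \<in> e3"
      using meet[OF e3 e(1)] meet[OF e(2) e3] by blast
    \<comment> \<open>If they were equal, this vertex would lie in \<open>e1\<close> and
      \<open>e2\<close>, hence be \<open>c\<close>, which is not in \<open>e3\<close>. So the three
      hyperedges form a triangle.\<close>
    have "a \<noteq> b"
      using hypertree_edges_meet_once[OF H e, of a c] ab c n by auto
    then have "is_cycle H [a, c, b] [e1, e2, e3]"
      using ab c n e e3 by (auto simp: is_cycle_def less_Suc_eq)
    then show False using H by (auto simp: hypertree_def)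
  qed
  then show ?thesis by blast
qed

section \<open>The number of vertices of a hypertree\<close>

text \<open>Growing a connected set of hyperedges one at a time, each new one meets the old vertices
  in a single vertex, since two would close a cycle.\<close>

lemma connected_subhypergraph_exists:
  assumes H: "hypertree H" "uniform k H" "1 \<le> k"
    and j: "1 \<le> j" "j \<le> card (hyperedges H)"
  shows "\<exists>F\<subseteq>hyperedges H. card F = j \<and> card (\<Union>F) = j * (k - 1) + 1 \<and>
    (\<forall>u\<in>\<Union>F. \<forall>v\<in>\<Union>F. (u, v) \<in> (joined F)\<^sup>*)"
  using j
proof (induction j rule: dec_induct)
  case base
  then obtain e where e: "e \<in> hyperedges H"
    by (metis card.empty all_not_in_conv not_one_le_zero)
  then have "card e = k" using H(2) by (auto simp: uniform_def)
  then show ?case using e H(3) by (intro exI[of _ "{e}"]) (auto simp: joined_def)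
next
  case (step j)
  let ?E = "hyperedges H"
  have hg: "hypergraph H" and con: "connected_hypergraph H" and acyc: "\<nexists>vs es. is_cycle H vs es"
    using H(1) by (auto simp: hypertree_def)
  obtain F where F: "F \<subseteq> ?E" "card F = j" "card (\<Union>F) = j * (k - 1) + 1"
    "\<And>u v. u \<in> \<Union>F \<Longrightarrow> v \<in> \<Union>F \<Longrightarrow> (u, v) \<in> (joined F)\<^sup>*"
    using step.IH[OF Suc_leD[OF step.prems]] by blast
  have finF: "finite F" and finU: "finite (\<Union>F)"
    using F(1) finite_hyperedges[OF hg] finite_hyperedge[OF hg] by (auto intro: finite_subset)
  have "F \<noteq> ?E" using F(2) step.prems by auto
  then obtain e0 where e0: "e0 \<in> ?E - F" using F(1) by blast
  have "\<exists>e\<in>?E - F. e \<inter> \<Union>F \<noteq> {}"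
  proof (rule ccontr)
    assume no: "\<not> (\<exists>e\<in>?E - F. e \<inter> \<Union>F \<noteq> {})"
    have "card e0 = k" using e0 H(2) by (auto simp: uniform_def)
    then obtain u where u: "u \<in> e0" using H(3) by fastforce
    have "card (\<Union>F) \<noteq> 0" unfolding F(3) by simp
    then have "\<Union>F \<noteq> {}" by (metis card.empty)
    then obtain w where w: "w \<in> \<Union>F" by blast
    have "(w, u) \<in> {(x, y). \<exists>e\<in>?E. x \<in> e \<and> y \<in> e}\<^sup>*"
      using con hg u w e0 F(1) unfolding connected_hypergraph_def hypergraph_def by blast
    \<comment> \<open>By \<open>no\<close>, every hyperedge that touches the vertices of
      \<open>F\<close> belongs to \<open>F\<close>, so a walk starting at \<open>w\<close> never
      leaves them.\<close>
    then have "u \<in> \<Union>F"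
      by (induction rule: rtrancl_induct) (use w no in blast)+
    then show False using no u e0 by blast
  qed
  then obtain e w where e: "e \<in> ?E" "e \<notin> F" and w: "w \<in> e" "w \<in> \<Union>F" by blast
  have "e \<inter> \<Union>F = {w}"
    using cycle_of_joined[OF F(1), of e w] F(4)[OF w(2)] e w acyc by blast
  moreover have "finite e" "card e = k"
    using finite_hyperedge[OF hg e(1)] H(2) e(1) by (auto simp: uniform_def)
  ultimately have "card (e \<union> \<Union>F) + 1 = k + (j * (k - 1) + 1)"
    using card_Un_Int[of e "\<Union>F"] finU F(3) by simp
  then have "card (\<Union>(insert e F)) = Suc j * (k - 1) + 1"
    using H(3) by simp
  moreover have "card (insert e F) = Suc j" using e F(2) finF by simp
  moreover have "(u, w) \<in> (joined (insert e F))\<^sup>*" if "u \<in> \<Union>(insert e F)" for u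
  proof (cases "u \<in> e")
    case True
    then show ?thesis using w by (auto simp: joined_def)
  next
    case False
    then have "(u, w) \<in> (joined F)\<^sup>*" using F(4)[of u w] that w by auto
    moreover have "joined F \<subseteq> joined (insert e F)" by (auto simp: joined_def)
    ultimately show ?thesis using rtrancl_mono by blast
  qed
  then have "(u, v) \<in> (joined (insert e F))\<^sup>*"
    if "u \<in> \<Union>(insert e F)" "v \<in> \<Union>(insert e F)" for u v
    using that joined_sym rtrancl_trans by meson
  ultimately show ?case using F(1) e
    by (intro exI[of _ "insert e F"]) (simp del: Union_insert)
qed

text \<open>An uncovered vertex is not reachable from any other one, and a hyperedge with k \<ge> 2
  elements guarantees that another one exists.\<close>

lemma uniform_hypertree_Union:
  assumes "hypertree H" "uniform k H" "2 \<le> k" "hyperedges H \<noteq> {}"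
  shows "\<Union>(hyperedges H) = {..<nverts H}"
proof
  have hg: "hypergraph H" and con: "connected_hypergraph H"
    using assms(1) by (auto simp: hypertree_def)
  then show "\<Union>(hyperedges H) \<subseteq> {..<nverts H}" by (auto simp: hypergraph_def)
  obtain e where e: "e \<in> hyperedges H" using assms(4) by blast
  have "card e \<le> card {..<nverts H}"
    using e hg by (intro card_mono) (auto simp: hypergraph_def)
  then have n: "2 \<le> nverts H" using e assms(2,3) by (auto simp: uniform_def)
  show "{..<nverts H} \<subseteq> \<Union>(hyperedges H)"
  proof
    fix v assume v: "v \<in> {..<nverts H}"
    obtain u where "u < nverts H" "u \<noteq> v"
      using n that[of 0] that[of 1] by (cases "v = 0") auto
    then have "(v, u) \<in> {(x, y). \<exists>e\<in>hyperedges H. x \<in> e \<and> y \<in> e}\<^sup>*"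
      using con v by (auto simp: connected_hypergraph_def)
    then show "v \<in> \<Union>(hyperedges H)"
      by (rule converse_rtranclE) (use \<open>u \<noteq> v\<close> in auto)
  qed
qed

text \<open>The order relates only hypergraphs with equally many vertices; this count makes all
  members of the class comparable.\<close>

lemma uniform_hypertree_nverts:
  assumes "hypertree H" "uniform k H" "2 \<le> k" "hyperedges H \<noteq> {}"
  shows "nverts H = card (hyperedges H) * (k - 1) + 1"
proof -
  have hg: "hypergraph H" using assms(1) by (auto simp: hypertree_def)
  note fin = finite_hyperedges[OF hg]
  have "1 \<le> card (hyperedges H)" using fin assms(4) by (simp add: Suc_le_eq card_gt_0_iff)
  then obtain F where "F \<subseteq> hyperedges H" "card F = card (hyperedges H)"
    "card (\<Union>F) = card (hyperedges H) * (k - 1) + 1"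
    using connected_subhypergraph_exists[OF assms(1,2) _ _ order_refl] assms(3) by auto
  moreover from this have "F = hyperedges H" using fin by (metis card_subset_eq)
  ultimately show ?thesis using uniform_hypertree_Union[OF assms] by simp
qed

section \<open>Degree sums by double counting\<close>

lemma sum_vertex_degree:
  assumes "hypergraph H" "uniform k H"
  shows "(\<Sum>i<nverts H. vertex_degree H i) = card (hyperedges H) * k"
proof -
  note fin = finite_hyperedges[OF assms(1)]
  have deg: "vertex_degree H i = (\<Sum>e\<in>hyperedges H. of_bool (i \<in> e))" for i
    using fin by (simp add: vertex_degree_def of_bool_def sum.inter_filter[symmetric])
  have "(\<Sum>i<nverts H. of_bool (i \<in> e)) = k" if "e \<in> hyperedges H" for e
  proof -
    have "{i \<in> {..<nverts H}. i \<in> e} = e" using that assms(1) by (auto simp: hypergraph_def)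
    then show ?thesis
      using that assms(2) by (simp add: of_bool_def sum.inter_filter[symmetric] uniform_def)
  qed
  then show ?thesis
    unfolding deg by (subst sum.swap) simp
qed

lemma sum_vertex_degree_sq:
  assumes "hypergraph H"
  shows "(\<Sum>i<nverts H. (vertex_degree H i)\<^sup>2)
    = (\<Sum>(e, e')\<in>hyperedges H \<times> hyperedges H. card (e \<inter> e'))"
proof -
  let ?E = "hyperedges H"
  note fin = finite_hyperedges[OF assms]
  have deg: "vertex_degree H i = (\<Sum>e\<in>?E. of_bool (i \<in> e))" for i
    using fin by (simp add: vertex_degree_def of_bool_def sum.inter_filter[symmetric])
  have sq: "(vertex_degree H i)\<^sup>2 = (\<Sum>(e, e')\<in>?E \<times> ?E. of_bool (i \<in> e \<inter> e'))" for i
    unfolding deg power2_eq_square sum_product sum.cartesian_product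
    by (intro sum.cong) auto
  have "(\<Sum>i<nverts H. of_bool (i \<in> e \<inter> e')) = card (e \<inter> e')"
    if "e \<in> ?E" for e e'
  proof -
    have "{i \<in> {..<nverts H}. i \<in> e \<and> i \<in> e'} = e \<inter> e'"
      using that assms by (auto simp: hypergraph_def)
    then show ?thesis by (simp add: of_bool_def sum.inter_filter[symmetric])
  qed
  then show ?thesis
    unfolding sq by (subst sum.swap) (auto intro!: sum.cong)
qed

lemma sum_vertex_degree_sq_less:
  assumes G: "hypertree G" "uniform k G" and H: "hypergraph H" "uniform k H"
    and card: "card (hyperedges G) = card (hyperedges H)"
    and disj: "e1 \<in> hyperedges G" "e2 \<in> hyperedges G" "e1 \<inter> e2 = {}" "e1 \<noteq> e2"
    and meet: "\<And>e e'. e \<in> hyperedges H \<Longrightarrow> e' \<in> hyperedges H \<Longrightarrow> e \<inter> e' \<noteq> {}"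
  shows "(\<Sum>i<nverts G. (vertex_degree G i)\<^sup>2) < (\<Sum>i<nverts H. (vertex_degree H i)\<^sup>2)"
proof -
  let ?E = "hyperedges G" and ?E' = "hyperedges H"
  \<comment> \<open>A majorant of \<open>card (e \<inter> e')\<close> for \<open>G\<close> and a
    minorant for \<open>H\<close>. Its total depends only on the number of hyperedges, so it can be
    carried over along an arbitrary bijection \<open>h\<close>.\<close>
  let ?g = "\<lambda>(e :: nat set, e' :: nat set). if e = e' then k else 1 :: nat"
  have hg: "hypergraph G" using G(1) by (simp add: hypertree_def)
  obtain h where h: "bij_betw h ?E ?E'"
    using card finite_hyperedges[OF hg] finite_hyperedges[OF H(1)] by (metis finite_same_card_bij)
  have "(\<Sum>(e, e')\<in>?E \<times> ?E. card (e \<inter> e')) < sum ?g (?E \<times> ?E)"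
  proof (rule sum_strict_mono_ex1)
    show "finite (?E \<times> ?E)" using finite_hyperedges[OF hg] by simp
    show "\<forall>x\<in>?E \<times> ?E. (case x of (e, e') \<Rightarrow> card (e \<inter> e')) \<le> ?g x"
      using G(2) hypertree_card_inter_le[OF G(1)] by (auto simp: uniform_def)
    show "\<exists>x\<in>?E \<times> ?E. (case x of (e, e') \<Rightarrow> card (e \<inter> e')) < ?g x"
      using disj by (intro bexI[of _ "(e1, e2)"]) auto
  qed
  also have "sum ?g (?E \<times> ?E) = (\<Sum>e\<in>?E. \<Sum>e'\<in>?E. if h e = h e' then k else 1)"
    unfolding sum.cartesian_product[symmetric] using h
    by (intro sum.cong refl) (auto simp: bij_betw_def inj_on_eq_iff)
  also have "\<dots> = (\<Sum>e\<in>?E'. \<Sum>e'\<in>?E'. if e = e' then k else 1)"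
    using sum.reindex_bij_betw[OF h, of "\<lambda>e. \<Sum>e'\<in>?E. if e = h e' then k else 1"]
      sum.reindex_bij_betw[OF h, of "\<lambda>e'. if e = e' then k else 1" for e] by simp
  also have "\<dots> = sum ?g (?E' \<times> ?E')"
    by (simp add: sum.cartesian_product)
  also have "\<dots> \<le> (\<Sum>(e, e')\<in>?E' \<times> ?E'. card (e \<inter> e'))"
  proof (rule sum_mono, clarsimp, intro conjI impI)
    fix e e' assume e: "e \<in> ?E'" "e' \<in> ?E'"
    show "k \<le> card e'" if "e = e'" using e H(2) by (auto simp: uniform_def)
    show "Suc 0 \<le> card (e \<inter> e')"
      using meet[OF e] finite_hyperedge[OF H(1) e(1)] by (simp add: Suc_le_eq card_gt_0_iff)
  qed
  finally show ?thesis
    unfolding sum_vertex_degree_sq[OF hg] sum_vertex_degree_sq[OF H(1)] .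
qed

section \<open>The hyperstar\<close>

definition star_block :: "nat \<Rightarrow> nat \<Rightarrow> nat set" where
  "star_block k j = {j * (k - 1) + 1 .. (j + 1) * (k - 1)}"

text \<open>The blocks start at vertex 1, so after a shift by one the block number is a quotient;
  disjointness and covering then become facts about \<open>div\<close>.\<close>

lemma star_block_iff:
  assumes "2 \<le> k"
  shows "x \<in> star_block k j \<longleftrightarrow> 1 \<le> x \<and> (x - 1) div (k - 1) = j"
proof -
  let ?d = "k - 1"
  have d: "0 < ?d" using assms by simp
  have "(x - 1) div ?d = j \<longleftrightarrow> j * ?d \<le> x - 1 \<and> x - 1 < (j + 1) * ?d"
    using d div_nat_eqI[of ?d j "x - 1"] div_times_less_eq_dividend[of "x - 1" ?d]
      dividend_less_times_div[of ?d "x - 1"] by (auto simp: mult.commute)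
  moreover have "x \<in> {a + 1..b} \<longleftrightarrow> 1 \<le> x \<and> a \<le> x - 1 \<and> x - 1 < b" for a b
    by auto
  ultimately show ?thesis unfolding star_block_def by blast
qed

lemma hyperedges_hyperstar:
  "hyperedges (hyperstar k m) = (\<lambda>j. insert 0 (star_block k j)) ` {..<m}"
  by (simp add: hyperstar_def star_block_def)

lemma nverts_hyperstar: "nverts (hyperstar k m) = m * (k - 1) + 1"
  by (simp add: hyperstar_def)

lemma star_block_disjoint: "2 \<le> k \<Longrightarrow> i \<noteq> j \<Longrightarrow> star_block k i \<inter> star_block k j = {}"
  by (auto simp: star_block_iff)

lemma zero_notin_star_block: "0 \<notin> star_block k j"
  by (simp add: star_block_def)

lemma finite_star_block: "finite (star_block k j)"
  by (simp add: star_block_def)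

lemma card_star_block: "card (star_block k j) = k - 1"
  by (simp add: star_block_def)

lemma Union_star_block:
  assumes "2 \<le> k"
  shows "(\<Union>j<m. star_block k j) = {..<m * (k - 1) + 1} - {0}"
proof -
  have "(x - 1) div (k - 1) < m \<longleftrightarrow> x < m * (k - 1) + 1" if "1 \<le> x" for x
    using assms that by (subst div_less_iff_less_mult) auto
  then show ?thesis using assms by (auto simp: star_block_iff)
qed

lemma star_block_inj:
  assumes "2 \<le> k" "insert 0 (star_block k i) = insert 0 (star_block k j)"
  shows "i = j"
proof (rule ccontr)
  assume "i \<noteq> j"
  moreover have "star_block k i = star_block k j"
    using assms(2) insert_ident[OF zero_notin_star_block zero_notin_star_block] by simp
  ultimately have "star_block k j = {}"
    using star_block_disjoint[OF assms(1), of i j] by auto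
  then show False using card_star_block[of k j] assms(1) by auto
qed

lemma hyperstar_in_uniform_hypertrees:
  assumes "2 \<le> k"
  shows "hyperstar k m \<in> uniform_hypertrees k m"
proof -
  let ?X = "hyperstar k m"
  have cover: "x = 0 \<or> (\<exists>j<m. x \<in> star_block k j)" if "x < nverts ?X" for x
    using Union_star_block[OF assms, of m] that unfolding nverts_hyperstar by blast
  have sub: "star_block k j \<subseteq> {..<nverts ?X}" if "j < m" for j
    using Union_star_block[OF assms, of m] that unfolding nverts_hyperstar by blast
  then have hg: "hypergraph ?X"
    by (auto simp: hypergraph_def hyperedges_hyperstar nverts_hyperstar)
  have to0: "(x, 0) \<in> (joined (hyperedges ?X))\<^sup>*" if "x < nverts ?X" for x
    using cover[OF that] by (auto simp: hyperedges_hyperstar joined_def)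
  have con: "connected_hypergraph ?X"
    unfolding connected_hypergraph_def joined_def[symmetric]
    using to0 joined_sym rtrancl_trans by meson
  have zero: "x = 0"
    if "e \<in> hyperedges ?X" "e' \<in> hyperedges ?X" "e \<noteq> e'" "x \<in> e" "x \<in> e'" for e e' x
    using that assms by (auto simp: hyperedges_hyperstar star_block_iff)
  have "\<not> is_cycle ?X vs es" for vs es
  proof
    assume c: "is_cycle ?X vs es"
    let ?l = "length es"
    have l: "2 \<le> ?l" "length vs = ?l" "distinct vs" "distinct es"
      "\<And>i. i < ?l \<Longrightarrow> es ! i \<in> hyperedges ?X"
      "\<And>i. i < ?l \<Longrightarrow> vs ! i \<in> es ! i \<and> vs ! (Suc i mod ?l) \<in> es ! i"
      using c by (auto simp: is_cycle_def)
    have lt: "0 < ?l" "1 < ?l" "?l - 1 < ?l" using l(1) by linarith+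
    \<comment> \<open>Each vertex of a cycle lies in two distinct hyperedges, which share only the
      centre 0. Two such vertices contradict distinctness.\<close>
    have "vs ! 1 = 0"
    proof (rule zero[OF l(5)[OF lt(1)] l(5)[OF lt(2)]])
      have "Suc 0 mod ?l = 1" using l(1) by simp
      then show "vs ! 1 \<in> es ! 0" using l(6)[OF lt(1)] by simp
      show "vs ! 1 \<in> es ! 1" using l(6)[OF lt(2)] by simp
      show "es ! 0 \<noteq> es ! 1" using nth_eq_iff_index_eq[OF l(4) lt(1,2)] by simp
    qed
    moreover have "vs ! 0 = 0"
    proof (rule zero[OF l(5)[OF lt(1)] l(5)[OF lt(3)]])
      show "vs ! 0 \<in> es ! 0" using l(6)[OF lt(1)] by simp
      have "Suc (?l - 1) mod ?l = 0" using lt(1) by simp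
      then show "vs ! 0 \<in> es ! (?l - 1)" using l(6)[OF lt(3)] by simp
      show "es ! 0 \<noteq> es ! (?l - 1)"
        unfolding nth_eq_iff_index_eq[OF l(4) lt(1,3)] using l(1) by simp
    qed
    ultimately show False
      using nth_eq_iff_index_eq[OF l(3), of 0 1] lt l(2) by simp
  qed
  moreover have "uniform k ?X"
    using assms by (auto simp: uniform_def hyperedges_hyperstar card_star_block
        zero_notin_star_block finite_star_block)
  moreover have "card (hyperedges ?X) = m"
    unfolding hyperedges_hyperstar
    by (subst card_image) (auto intro!: inj_onI dest: star_block_inj[OF assms])
  ultimately show ?thesis
    using hg con by (auto simp: uniform_hypertrees_def hypertree_def)
qed

text \<open>Without \<open>c\<close> the hyperedges become disjoint petals of \<open>k - 1\<close>
  vertices that cover everything else. Arbitrary bijections from petals to blocks glue together,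
  with \<open>c\<close> sent to 0.\<close>

lemma isomorphic_hyperstar:
  assumes G: "hypertree G" "uniform k G" "2 \<le> k" and m: "card (hyperedges G) = m" "1 \<le> m"
    and c: "\<And>e. e \<in> hyperedges G \<Longrightarrow> c \<in> e"
  shows "isomorphic G (hyperstar k m)"
proof -
  let ?E = "hyperedges G"
  have hg: "hypergraph G" using G(1) by (simp add: hypertree_def)
  have ne: "?E \<noteq> {}" using m by auto
  obtain \<epsilon> where \<epsilon>: "bij_betw \<epsilon> {..<m} ?E"
    using finite_hyperedges[OF hg] m(1) by (metis finite_lessThan card_lessThan finite_same_card_bij)
  then have \<epsilon>E: "\<epsilon> j \<in> ?E" if "j < m" for j
    using that by (auto simp: bij_betw_def)
  define A where "A j = \<epsilon> j - {c}" for j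
  have A: "A i \<inter> A j = {}" if "i < m" "j < m" "i \<noteq> j" for i j
  proof -
    have "\<epsilon> i \<noteq> \<epsilon> j" using that \<epsilon> by (auto simp: bij_betw_def inj_on_def)
    then show ?thesis
      using hypertree_edges_meet_once[OF G(1) \<epsilon>E[OF that(1)] \<epsilon>E[OF that(2)], of c]
        c[OF \<epsilon>E[OF that(1)]] c[OF \<epsilon>E[OF that(2)]] unfolding A_def by blast
  qed
  have "\<exists>\<phi>. bij_betw \<phi> (A j) (star_block k j)" if "j < m" for j
  proof (rule finite_same_card_bij)
    show "finite (A j)" unfolding A_def using finite_hyperedge[OF hg \<epsilon>E[OF that]] by simp
    show "finite (star_block k j)" by (rule finite_star_block)
    show "card (A j) = card (star_block k j)"
      using c[OF \<epsilon>E[OF that]] G(2) \<epsilon>E[OF that] by (simp add: A_def card_star_block uniform_def)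
  qed
  then obtain \<phi> where \<phi>: "\<And>j. j < m \<Longrightarrow> bij_betw (\<phi> j) (A j) (star_block k j)" by metis
  \<comment> \<open>The description is well defined, because a vertex other than \<open>c\<close>
    lies in exactly one petal.\<close>
  define f where "f v = (if v = c then 0 else \<phi> (THE j. j < m \<and> v \<in> A j) v)" for v
  have fA: "f v = \<phi> j v" if "j < m" "v \<in> A j" for j v
  proof -
    have "(THE j. j < m \<and> v \<in> A j) = j" using that A by blast
    then show ?thesis using that by (simp add: f_def A_def)
  qed
  have bA: "bij_betw f (A j) (star_block k j)" if "j < m" for j
    using \<phi>[OF that] fA[OF that] by (simp cong: bij_betw_cong)
  have "bij_betw f (\<Union>j<m. A j) (\<Union>j<m. star_block k j)"
  proof (rule bij_betw_UNION_disjoint)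
    show "disjoint_family_on (star_block k) {..<m}"
      using star_block_disjoint[OF G(3)] by (auto simp: disjoint_family_on_def)
  qed (use bA in auto)
  moreover have "(\<Union>j<m. A j) = {..<nverts G} - {c}"
  proof -
    have "(\<Union>j<m. \<epsilon> j) = \<Union>?E" using \<epsilon> by (auto simp: bij_betw_def)
    then show ?thesis
      unfolding uniform_hypertree_Union[OF G ne, symmetric] A_def by blast
  qed
  ultimately have "bij_betw f ({..<nverts G} - {c}) ({..<nverts (hyperstar k m)} - {0})"
    by (simp add: Union_star_block[OF G(3)] nverts_hyperstar)
  moreover have "bij_betw f {c} {0}" by (simp add: f_def bij_betw_def)
  ultimately have "bij_betw f ({..<nverts G} - {c} \<union> {c}) ({..<nverts (hyperstar k m)} - {0} \<union> {0})"
    by (rule bij_betw_combine) simp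
  moreover have "{..<nverts G} - {c} \<union> {c} = {..<nverts G}"
    using uniform_hypertree_Union[OF G ne] c ne by blast
  moreover have "{..<nverts (hyperstar k m)} - {0} \<union> {0} = {..<nverts (hyperstar k m)}"
    by (auto simp: nverts_hyperstar)
  ultimately have "bij_betw f {..<nverts G} {..<nverts (hyperstar k m)}" by simp
  moreover have "hyperedges (hyperstar k m) = (\<lambda>e. f ` e) ` ?E"
  proof -
    have "f ` \<epsilon> j = insert 0 (star_block k j)" if "j < m" for j
    proof -
      have "\<epsilon> j = insert c (A j)" using c[OF \<epsilon>E[OF that]] by (auto simp: A_def)
      then have "f ` \<epsilon> j = insert (f c) (f ` A j)" by simp
      then show ?thesis using bA[OF that] by (simp add: bij_betw_def f_def)
    qed
    then have "(\<lambda>j. insert 0 (star_block k j)) ` {..<m} = (\<lambda>j. f ` \<epsilon> j) ` {..<m}"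
      by (intro image_cong) auto
    also have "\<dots> = (\<lambda>e. f ` e) ` ?E"
      using bij_betw_imp_surj_on[OF \<epsilon>] by (metis image_image)
    finally show ?thesis by (simp add: hyperedges_hyperstar)
  qed
  ultimately show ?thesis unfolding isomorphic_def by blast
qed

section \<open>Maximality of the hyperstar\<close>

theorem theorem6p4:
  fixes k m :: nat and \<alpha> :: real
  assumes "2 \<le> k" and "1 \<le> m" and "0 < \<alpha>" and "\<alpha> < 1"
  shows "S_last \<alpha> k (uniform_hypertrees k m) (hyperstar k m)"
proof -
  let ?X = "hyperstar k m"
  have X: "hypertree ?X" "uniform k ?X" "card (hyperedges ?X) = m"
    using hyperstar_in_uniform_hypertrees[OF assms(1), of m] by (auto simp: uniform_hypertrees_def)
  have "S_less \<alpha> k G ?X" if GC: "G \<in> uniform_hypertrees k m" and ni: "\<not> isomorphic G ?X" for G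
  proof -
    have G: "hypertree G" "uniform k G" "card (hyperedges G) = m"
      using GC by (auto simp: uniform_hypertrees_def)
    have hg: "hypergraph G" "hypergraph ?X" using G X by (auto simp: hypertree_def)
    have ne: "hyperedges G \<noteq> {}" "{} \<notin> hyperedges G"
      using G assms by (auto simp: uniform_def)
    have "\<nexists>c. \<forall>e\<in>hyperedges G. c \<in> e"
      using isomorphic_hyperstar[OF G(1,2) assms(1) G(3) assms(2)] ni by blast
    then obtain e1 e2 where e: "e1 \<in> hyperedges G" "e2 \<in> hyperedges G" "e1 \<inter> e2 = {}"
      using hypertree_intersecting_imp_common[OF G(1) ne] by blast
    then have "e1 \<noteq> e2" using ne by auto
    have less: "(\<Sum>i<nverts G. (vertex_degree G i)\<^sup>2) < (\<Sum>i<nverts ?X. (vertex_degree ?X i)\<^sup>2)"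
      by (rule sum_vertex_degree_sq_less[OF G(1,2) hg(2) X(2) _ e \<open>e1 \<noteq> e2\<close>])
        (auto simp: G(3) X(3), auto simp: hyperedges_hyperstar)
    define n where "n = nverts ?X"
    have n: "nverts G = n" "nverts ?X = n"
      using uniform_hypertree_nverts[OF G(1,2) assms(1) ne(1)] G(3)
      by (simp_all add: n_def nverts_hyperstar)
    \<comment> \<open>The disjoint pair serves a second time: it forces enough vertices for the
      trace formulas and for order 2 to be admissible.\<close>
    have "card (e1 \<union> e2) \<le> card {..<n}"
      using e hg(1) n(1) by (intro card_mono) (auto simp: hypergraph_def)
    moreover have "card (e1 \<union> e2) = k + k"
      using e finite_hyperedge[OF hg(1)] G(2) by (simp add: card_Un_disjoint uniform_def)
    ultimately have n4: "4 \<le> n" using assms(1) by simp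
    define c where "c = real (card (reduced_at n (k - 1) 0))"
    have c: "0 < c" unfolding c_def using card_reduced_at_pos[of "k - 1" 0 n] assms(1) n4 by simp
    have deg: "(\<Sum>i<n. real (vertex_degree G i)) = (\<Sum>i<n. real (vertex_degree ?X i))"
      using sum_vertex_degree[OF hg(1) G(2)] sum_vertex_degree[OF hg(2) X(2)] G(3) X(3) n
      by (simp flip: of_nat_sum)
    have "real (\<Sum>i<n. (vertex_degree G i)\<^sup>2) < real (\<Sum>i<n. (vertex_degree ?X i)\<^sup>2)"
      using less unfolding n of_nat_less_iff .
    then have deg2: "(\<Sum>i<n. (real (vertex_degree G i))\<^sup>2) < (\<Sum>i<n. (real (vertex_degree ?X i))\<^sup>2)"
      by (simp only: of_nat_sum of_nat_power)
    have n3: "3 \<le> n" using n4 by simp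
    note trG = tensor_trace_alpha[OF assms(1) n3 G(2) hg(1) n(1), of \<alpha>, folded c_def]
    note trX = tensor_trace_alpha[OF assms(1) n3 X(2) hg(2) n(2), of \<alpha>, folded c_def]
    have "tensor_trace t n k (alpha_tensor \<alpha> k G) = tensor_trace t n k (alpha_tensor \<alpha> k ?X)"
      if "t < 2" for t
      using that trG(1,2) trX(1,2) deg by (cases t) auto
    moreover have "tensor_trace 2 n k (alpha_tensor \<alpha> k G)
        < tensor_trace 2 n k (alpha_tensor \<alpha> k ?X)"
      unfolding trG(3) trX(3) deg using deg2 c assms(3) by simp
    moreover have "2 \<in> {1..n * (k - 1) ^ (n - 1) - 1}"
    proof -
      have "4 * 1 \<le> n * (k - 1) ^ (n - 1)"
        using n4 assms(1) by (intro mult_le_mono) auto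
      then show ?thesis by simp
    qed
    ultimately show ?thesis
      unfolding S_less_def Let_def n by blast
  qed
  then show ?thesis
    using hyperstar_in_uniform_hypertrees[OF assms(1)] by (auto simp: S_last_def)
qed

end
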